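(* Let $V$ be an $n$-dimensional real vector space, $n>4$, with a Lorentz metric $g$ of signature $(-+\dots+)$, and let $T=T^a{}_b$ be a real tensor that is symmetric with respect to $g$. Then $T$ is the superenergy tensor of a 2-form of rank at most four if and only if (a) $T$ satisfies the dominant energy condition, and (b) $\displaystyle\Bigl(T^2-\frac14[T^2]+\frac{1}{4(n-4)}[T]^2\Bigr)\Bigl(T-\frac{1}{n-4}[T]\Bigr)=0$. Further, if $(n-4)^2[T^2]<n[T]^2$ then the 2-form is the sum of two simple spacelike 2-forms, and if $(n-4)^2[T^2]>n[T]^2$ then the 2-form is the sum of one simple spacelike 2-form and one simple 2-form containing a timelike direction.
   Context: Indices are raised and lowered with $g$. $T$ symmetric with respect to $g$ means $g_{ac}T^c{}_b=g_{bc}T^c{}_a$. Index-free notation: products denote composition of $(1,1)$-tensors, $[X]=X^c{}_c$ is the trace, and scalar terms are multiplied by the identity $\delta^a_b$. $T$ is the superenergy tensor of a 2-form $F_{ab}$ if $T^a{}_b=F^{ac}F_{bc}-\frac14F^{cd}F_{cd}\delta^a_b$. The rank of a 2-form $F$ is the dimension of the span of $\{F_{ab}u^b\}$ as $u$ varies. The dominant energy condition means $T_{ab}u^av^b\geq0$ (with $T_{ab}=g_{ac}T^c{}_b$) for every pair of future-pointing causal vectors $u,v$. A simple 2-form is $u_{[a}v_{b]}$ for vectors $u,v$; it is spacelike if the plane spanned by $u,v$ contains only spacelike nonzero vectors, and it contains a timelike direction if this plane contains a timelike vector. *)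

theory Defs
  imports "HOL-Analysis.Analysis"
begin

text \<open>V = real^'n with n = CARD('n). Tensors are matrices in a fixed basis:
  a (1,1)-tensor T^a_b is T $ a $ b; a covariant 2-tensor F_ab is F $ a $ b;
  the metric g_ab is g $ a $ b and its inverse g^ab is matrix_inv g.\<close>

definition minkowski_diag :: "'n \<Rightarrow> real^'n^'n" where
  "minkowski_diag i0 = (\<chi> a b. if a = b then (if a = i0 then -1 else 1) else 0)"

definition lorentz_metric :: "real^'n^'n \<Rightarrow> bool" where
  "lorentz_metric g \<longleftrightarrow> transpose g = g \<and>
     (\<exists>(P::real^'n^'n) i0. invertible P \<and> transpose P ** g ** P = minkowski_diag i0)"

definition gprod :: "real^'n^'n \<Rightarrow> real^'n \<Rightarrow> real^'n \<Rightarrow> real" where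
  "gprod g u v = u \<bullet> (g *v v)"

definition g_symmetric :: "real^'n^'n \<Rightarrow> real^'n^'n \<Rightarrow> bool" where
  "g_symmetric g T \<longleftrightarrow> (\<forall>a b. (g ** T) $ a $ b = (g ** T) $ b $ a)"

definition two_form :: "real^'n^'n \<Rightarrow> bool" where
  "two_form F \<longleftrightarrow> transpose F = - F"

definition form_rank :: "real^'n^'n \<Rightarrow> nat" where
  "form_rank F = dim (range (\<lambda>u. F *v u))"

definition raise2 :: "real^'n^'n \<Rightarrow> real^'n^'n \<Rightarrow> real^'n^'n" where
  "raise2 g F = matrix_inv g ** F ** matrix_inv g"

definition superenergy :: "real^'n^'n \<Rightarrow> real^'n^'n \<Rightarrow> real^'n^'n" where
  "superenergy g F =
     (\<chi> a b. (\<Sum>c\<in>UNIV. raise2 g F $ a $ c * F $ b $ c)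
             - (1/4) * (\<Sum>c\<in>UNIV. \<Sum>d\<in>UNIV. raise2 g F $ c $ d * F $ c $ d)
               * (if a = b then 1 else 0))"

text \<open>Time orientation given by a timelike vector tau: u is future-pointing causal
  iff u \<noteq> 0, g(u,u) \<le> 0 and g(u,tau) < 0.\<close>
definition future_causal :: "real^'n^'n \<Rightarrow> real^'n \<Rightarrow> real^'n \<Rightarrow> bool" where
  "future_causal g tau u \<longleftrightarrow> u \<noteq> 0 \<and> gprod g u u \<le> 0 \<and> gprod g u tau < 0"

definition dominant_energy :: "real^'n^'n \<Rightarrow> real^'n \<Rightarrow> real^'n^'n \<Rightarrow> bool" where
  "dominant_energy g tau T \<longleftrightarrow>
     (\<forall>u v. future_causal g tau u \<longrightarrow> future_causal g tau v \<longrightarrow>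
        (\<Sum>a\<in>UNIV. \<Sum>b\<in>UNIV. (g ** T) $ a $ b * u $ a * v $ b) \<ge> 0)"

text \<open>Simple 2-form u_[a v_b] with u_a = g_ab u^b.\<close>
definition wedge :: "real^'n^'n \<Rightarrow> real^'n \<Rightarrow> real^'n \<Rightarrow> real^'n^'n" where
  "wedge g u v = (\<chi> a b. ((g *v u) $ a * (g *v v) $ b - (g *v u) $ b * (g *v v) $ a) / 2)"

definition simple_spacelike :: "real^'n^'n \<Rightarrow> real^'n^'n \<Rightarrow> bool" where
  "simple_spacelike g F \<longleftrightarrow>
     (\<exists>u v. F = wedge g u v \<and> (\<forall>w\<in>span {u, v}. w \<noteq> 0 \<longrightarrow> gprod g w w > 0))"

definition simple_timelike :: "real^'n^'n \<Rightarrow> real^'n^'n \<Rightarrow> bool" where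
  "simple_timelike g F \<longleftrightarrow>
     (\<exists>u v. F = wedge g u v \<and> (\<exists>w\<in>span {u, v}. gprod g w w < 0))"

end

theory Submission
  imports Defs
begin

text \<open>
  For a two-form \<open>F\<close> with mixed components \<open>A\<close> the superenergy tensor is \<open>T = s - A\<^sup>2\<close> with
  \<open>s = [A\<^sup>2]/4 = [T]/(n-4)\<close>. If \<open>F\<close> has rank at most four, it is a sum of two simple forms, and
  the Cayley-Hamilton equation of \<open>A\<close> on the span of the four vectors involved yields (b), which
  reads \<open>(T\<^sup>2 - q)(T - s) = 0\<close> with \<open>4 q = [T\<^sup>2] - (n-4) s\<^sup>2\<close>. The dominant energy condition is checked
  in a frame adapted to a timelike vector.

  Conversely, the projections onto the eigenspaces of \<open>T\<close> are polynomials in \<open>T\<close>, and their traces, which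
  are the multiplicities, are determined by \<open>[T]\<close> and \<open>[T\<^sup>2]\<close>: two for each of \<open>sqrt q\<close> and \<open>- sqrt q\<close>, and
  \<open>n-4\<close> for \<open>s\<close>. The dominant energy condition decides which eigenspace contains the timelike
  direction: that of \<open>s\<close> if \<open>q < s\<^sup>2\<close>, that of \<open>- sqrt q\<close> if \<open>q > s\<^sup>2\<close>. If \<open>q = s\<^sup>2\<close>, there may in addition
  be a nilpotent part \<open>c k \<otimes> k\<close> with \<open>k\<close> null and \<open>c \<ge> 0\<close>. In each case a square root of \<open>s - T\<close> is read off
  from orthonormal bases of the eigenspaces. As \<open>A\<close> commutes with \<open>T\<close> and its range is that of
  \<open>T - s\<close> when \<open>q \<noteq> s\<^sup>2\<close>, the same eigenspaces determine the types of the two simple forms.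
\<close>

section \<open>Traces of operators\<close>

text \<open>Operators are kept as functions, so that their powers and rank-one maps need no matrix
  representation.\<close>

definition op_trace :: "(real^'n \<Rightarrow> real^'n) \<Rightarrow> real" where
  "op_trace f = (\<Sum>i\<in>UNIV. f (axis i 1) $ i)"

lemma op_trace_matrix: "op_trace (\<lambda>x. M *v x) = trace M"
  by (simp add: op_trace_def trace_def matrix_vector_mult_basis column_def)

lemma op_trace_add: "op_trace (\<lambda>x. f x + h x) = op_trace f + op_trace h"
  by (simp add: op_trace_def sum.distrib)

lemma op_trace_diff: "op_trace (\<lambda>x. f x - h x) = op_trace f - op_trace h"
  by (simp add: op_trace_def sum_subtractf)

lemma op_trace_minus: "op_trace (\<lambda>x. - f x) = - op_trace f"
  by (simp add: op_trace_def sum_negf)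

lemma op_trace_scaleR: "op_trace (\<lambda>x. c *\<^sub>R f x) = c * op_trace f"
  by (simp add: op_trace_def sum_distrib_left)

lemma op_trace_ident: "op_trace (\<lambda>x::real^'n. x) = real CARD('n)"
  by (simp add: op_trace_def axis_def)

lemma op_trace_zero: "op_trace (\<lambda>x. 0) = 0"
  by (simp add: op_trace_def)

lemma op_trace_sum: "op_trace (\<lambda>x. \<Sum>e\<in>S. f e x) = (\<Sum>e\<in>S. op_trace (f e))"
  unfolding op_trace_def by (simp add: sum.swap [of _ S])

lemma op_trace_rank_one: "op_trace (\<lambda>x. (w \<bullet> x) *\<^sub>R z) = w \<bullet> z"
  by (simp add: op_trace_def inner_axis inner_vec_def [of w z])

lemmas op_trace_simps = op_trace_add op_trace_diff op_trace_minus op_trace_scaleR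
  op_trace_ident op_trace_zero op_trace_sum

section \<open>Lorentzian inner products\<close>

text \<open>The signature is captured by two facts: a timelike vector exists, and \<open>g\<close>
  is positive definite on the orthogonal complement of every timelike vector. All statements about
  causal vectors are deduced from these.\<close>

locale lorentz_space =
  fixes g :: "real^'n^'n"
  assumes sym_g: "transpose g = g"
    and timelike_ex: "\<exists>t. gprod g t t < 0"
    and reverse: "gprod g t t < 0 \<Longrightarrow> gprod g t x = 0 \<Longrightarrow> x \<noteq> 0 \<Longrightarrow> gprod g x x > 0"
begin

abbreviation G :: "real^'n \<Rightarrow> real^'n \<Rightarrow> real" where "G \<equiv> gprod g"

definition symmetric_op :: "(real^'n \<Rightarrow> real^'n) \<Rightarrow> bool" where
  "symmetric_op f \<longleftrightarrow> linear f \<and> (\<forall>x y. G (f x) y = G x (f y))"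

definition projection :: "(real^'n \<Rightarrow> real^'n) \<Rightarrow> bool" where
  "projection P \<longleftrightarrow> symmetric_op P \<and> (\<forall>x. P (P x) = P x)"

definition orthonormal :: "(real^'n) set \<Rightarrow> bool" where
  "orthonormal S \<longleftrightarrow> finite S \<and> (\<forall>e\<in>S. G e e = 1 \<or> G e e = -1)
     \<and> (\<forall>e\<in>S. \<forall>f\<in>S. e \<noteq> f \<longrightarrow> G e f = 0)"

lemma G_commute: "G x y = G y x"
proof -
  have "x \<bullet> (g *v y) = (transpose g *v x) \<bullet> y" by (simp add: dot_lmul_matrix)
  then show ?thesis by (simp add: gprod_def sym_g inner_commute)
qed

lemma G_lower: "G x y = (g *v x) \<bullet> y"
  by (metis G_commute gprod_def inner_commute)

lemma G_simps [simp]: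
  "G (x + y) z = G x z + G y z" "G z (x + y) = G z x + G z y"
  "G (x - y) z = G x z - G y z" "G z (x - y) = G z x - G z y"
  "G (- x) z = - G x z" "G z (- x) = - G z x"
  "G (c *\<^sub>R x) z = c * G x z" "G z (c *\<^sub>R x) = c * G z x"
  "G 0 z = 0" "G z 0 = 0"
  by (simp_all add: gprod_def inner_simps matrix_vector_right_distrib
      matrix_vector_mult_diff_distrib matrix_vector_mult_scaleR inner_commute
      linear_neg [OF matrix_vector_mul_linear])

lemma G_sum_right: "G z (\<Sum>e\<in>S. f e) = (\<Sum>e\<in>S. G z (f e))"
  by (induction S rule: infinite_finite_induct) auto

lemma G_sum_left: "G (\<Sum>e\<in>S. f e) z = (\<Sum>e\<in>S. G (f e) z)"
  by (induction S rule: infinite_finite_induct) auto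

lemma op_trace_G: "op_trace (\<lambda>x. G w x *\<^sub>R z) = G w z"
  by (simp add: G_lower op_trace_rank_one)

lemma nondegenerate:
  assumes "\<And>y. G x y = 0" shows "x = 0"
  using timelike_ex reverse assms G_commute by (metis less_irrefl)

lemma orthogonal_timelike_nonneg: "G t t < 0 \<Longrightarrow> G t x = 0 \<Longrightarrow> G x x \<ge> 0"
  using reverse[of t x] by (cases "x = 0") auto

lemma causal_not_orthogonal: "G t t < 0 \<Longrightarrow> G x x \<le> 0 \<Longrightarrow> x \<noteq> 0 \<Longrightarrow> G x t \<noteq> 0"
  using reverse[of t x] by (auto simp: G_commute)

text \<open>Subtracting the multiple of \<open>w\<close> that makes the remainder orthogonal to a
  timelike \<open>t\<close> keeps the norm nonpositive, as \<open>w\<close> is null and orthogonal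
  to \<open>x\<close>; such a remainder must vanish.\<close>

lemma null_orthogonal_parallel:
  assumes "G w w = 0" "w \<noteq> 0" "G x w = 0" "G x x \<le> 0"
  shows "\<exists>m. x = m *\<^sub>R w"
proof -
  obtain t where t: "G t t < 0" using timelike_ex by blast
  have wt: "G w t \<noteq> 0" using causal_not_orthogonal[OF t] assms by simp
  define z where "z = x - (G x t / G w t) *\<^sub>R w"
  have "G t z = 0" using wt by (simp add: z_def G_commute)
  moreover have "G z z \<le> 0" using assms by (simp add: z_def G_commute)
  ultimately have "z = 0" using reverse[OF t, of z] by force
  then show ?thesis unfolding z_def by (metis eq_iff_diff_eq_0)
qed

section \<open>Symmetric projections and their orthonormal bases\<close>

lemma symmetric_opD: "symmetric_op f \<Longrightarrow> linear f" "symmetric_op f \<Longrightarrow> G (f x) y = G x (f y)"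
  by (auto simp: symmetric_op_def)

lemma projectionD:
  assumes "projection P"
  shows "symmetric_op P" "linear P" "P (P x) = P x" "G (P x) y = G x (P y)"
  using assms by (auto simp: projection_def symmetric_op_def)

lemma projection_complement:
  assumes "projection P" shows "projection (\<lambda>x. x - P x)"
  using projectionD[OF assms] unfolding projection_def symmetric_op_def
  by (auto simp: linear_diff linear_compose_sub linear_id[unfolded id_def])

lemma orthonormal_expansion_fixed:
  assumes "orthonormal S" "e \<in> S"
  shows "(\<Sum>f\<in>S. (G f f * G f e) *\<^sub>R f) = e"
proof -
  have "(\<Sum>f\<in>S. (G f f * G f e) *\<^sub>R f) = (\<Sum>f\<in>S. if f = e then e else 0)"
    by (rule sum.cong) (use assms in \<open>auto simp: orthonormal_def\<close>)
  then show ?thesis using assms by (simp add: orthonormal_def)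
qed

text \<open>Induction on the dimension of the range. Polarization and nondegeneracy yield a vector
  of nonzero norm in the range; normalized to \<open>e\<close>, it is split off, and the remainder
  is a symmetric projection of smaller rank.\<close>

lemma projection_orthonormal_basis:
  assumes "projection P"
  obtains S where "orthonormal S" "\<And>x. P x = (\<Sum>e\<in>S. (G e e * G e x) *\<^sub>R e)"
    "op_trace P = real (card S)" "\<And>e. e \<in> S \<Longrightarrow> P e = e"
proof -
  have "\<exists>S. orthonormal S \<and> (\<forall>x. P x = (\<Sum>e\<in>S. (G e e * G e x) *\<^sub>R e))"
    using assms
  proof (induction "dim (range P)" arbitrary: P rule: less_induct)
    case less
    note P = projectionD[OF less.prems]
    show ?case
    proof (cases "\<forall>x. P x = 0")
      case True
      then have "orthonormal {} \<and> (\<forall>x. P x = (\<Sum>e\<in>{}. (G e e * G e x) *\<^sub>R e))"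
        by (simp add: orthonormal_def)
      then show ?thesis by blast
    next
      case False
      have "\<exists>x. G (P x) (P x) \<noteq> 0"
      proof (rule ccontr)
        assume *: "\<not> ?thesis"
        have "G (P x) y = 0" for x y
        proof -
          have "G (P (x + y)) (P (x + y)) = 0" using * by blast
          then have "G (P x) (P y) = 0" using * by (simp add: linear_add[OF P(2)] G_commute)
          then show ?thesis by (simp add: P(3,4) flip: P(4))
        qed
        then show False using nondegenerate False by blast
      qed
      then obtain x where x: "G (P x) (P x) \<noteq> 0" by blast
      define e where "e = (1 / sqrt \<bar>G (P x) (P x)\<bar>) *\<^sub>R P x"
      define c where "c = G e e"
      have c: "c = 1 \<or> c = -1"
      proof -
        have "c = G (P x) (P x) / (sqrt \<bar>G (P x) (P x)\<bar> * sqrt \<bar>G (P x) (P x)\<bar>)"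
          by (simp add: c_def e_def)
        also have "\<dots> = G (P x) (P x) / \<bar>G (P x) (P x)\<bar>" by simp
        finally show ?thesis using x by (auto simp: abs_if)
      qed
      have Pe: "P e = e" by (simp add: e_def linear_scale[OF P(2)] P(3))
      have e0: "e \<noteq> 0" using c by (auto simp: c_def)
      \<comment> \<open>The sign \<open>c = G e e\<close> is its own inverse, so one formula removes
        a spacelike or a timelike \<open>e\<close>.\<close>
      define P' where "P' y = P y - (c * G e y) *\<^sub>R e" for y
      have lin: "linear P'" 
        by (intro linearI) (auto simp: P'_def linear_add[OF P(2)] linear_scale[OF P(2)] algebra_simps)
      have cc: "c * c = 1" using c by auto
      have GP: "G e (P y) = G e y" for y using P(4)[of e y] Pe by simp
      have "P' (P' y) = P' y" for y
        using cc by (simp add: P'_def linear_diff[OF P(2)] linear_scale[OF P(2)] P(3) Pe GP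
            algebra_simps c_def[symmetric]) (simp add: mult.assoc[symmetric])
      moreover have "G (P' y) z = G y (P' z)" for y z
        by (simp add: P'_def P(4) G_commute[of y e])
      ultimately have proj: "projection P'" using lin by (auto simp: projection_def symmetric_op_def)
      note P' = projectionD[OF proj]
      have P'e: "P' e = 0" using cc by (simp add: P'_def Pe c_def[symmetric])
      have enot: "e \<notin> range P'"
      proof
        assume "e \<in> range P'"
        then obtain z where "e = P' z" by blast
        then have "P' e = e" using P'(3) by simp
        then show False using P'e e0 by simp
      qed
      have sub: "subspace (range P')" using lin linear_subspace_image subspace_UNIV by blast
      have "range P' \<subseteq> range P"
      proof
        fix w assume "w \<in> range P'"
        then obtain y where "w = P' y" by blast
        then have "w = P (y - (c * G e y) *\<^sub>R e)"
          by (simp add: P'_def linear_diff[OF P(2)] linear_scale[OF P(2)] Pe)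
        then show "w \<in> range P" by blast
      qed
      moreover have "e \<in> range P" using Pe by (metis rangeI)
      ultimately have "dim (insert e (range P')) \<le> dim (range P)"
        by (intro dim_subset) auto
      moreover have "dim (insert e (range P')) = dim (range P') + 1"
        using enot sub by (simp add: dim_insert span_eq_iff[THEN iffD2])
      ultimately have "dim (range P') < dim (range P)" by simp
      from less.hyps[OF this proj] obtain S where S: "orthonormal S"
        and PS: "\<And>x. P' x = (\<Sum>e\<in>S. (G e e * G e x) *\<^sub>R e)" by blast
      have orth: "G e f = 0" if "f \<in> S" for f
      proof -
        have "P' f = f" using orthonormal_expansion_fixed[OF S that] PS by simp
        then have "G e f = G (P' e) f" by (metis P'(4))
        then show ?thesis by (simp add: P'e)
      qed
      then have "e \<notin> S" using c by (auto simp: c_def)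
      moreover have "finite S" using S by (simp add: orthonormal_def)
      ultimately have "P x = (\<Sum>e\<in>insert e S. (G e e * G e x) *\<^sub>R e)" for x
        using PS[of x] by (simp add: P'_def c_def algebra_simps)
      moreover have "orthonormal (insert e S)" using S orth c by (auto simp: orthonormal_def c_def G_commute)
      ultimately show ?thesis by blast
    qed
  qed
  then obtain S where S: "orthonormal S" and PS: "\<And>x. P x = (\<Sum>e\<in>S. (G e e * G e x) *\<^sub>R e)" by blast
  \<comment> \<open>Each rank-one term contributes \<open>(G e e)^2 = 1\<close> to the trace,
    whatever the causal type of \<open>e\<close>.\<close>
  have "P = (\<lambda>x. \<Sum>e\<in>S. G e e *\<^sub>R (G e x *\<^sub>R e))" using PS by auto
  then have "op_trace P = (\<Sum>e\<in>S. G e e * G e e)"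
    by (simp add: op_trace_simps op_trace_G del: scaleR_scaleR)
  also have "\<dots> = (\<Sum>e\<in>S. 1)" by (rule sum.cong) (use S in \<open>auto simp: orthonormal_def\<close>)
  finally have "op_trace P = real (card S)" by simp
  moreover have "P e = e" if "e \<in> S" for e using PS orthonormal_expansion_fixed[OF S that] by simp
  ultimately show thesis using that S PS by blast
qed

lemma projection_orthogonal: "projection Q \<Longrightarrow> G (Q x) (y - Q y) = 0"
  using projectionD[of Q] by (simp add: linear_diff)

text \<open>Range and kernel of a symmetric projection are orthogonal, so a timelike vector in the
  range makes the kernel spacelike.\<close>

lemma projection_complement_positive:
  assumes "projection Q" "G (Q t) (Q t) < 0" "x \<noteq> Q x"
  shows "G (x - Q x) (x - Q x) > 0"
  using reverse[OF assms(2) projection_orthogonal[OF assms(1)]] assms(3) by simp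

lemma projection_positive:
  assumes "projection Q" "G (t - Q t) (t - Q t) < 0" "Q x \<noteq> 0"
  shows "G (Q x) (Q x) > 0"
  using projection_complement_positive[OF projection_complement[OF assms(1)], of t x] assms
    projectionD[OF assms(1)] by simp

lemma projection_timelike_cases:
  assumes "projection Q"
  obtains t where "G (Q t) (Q t) < 0" | t where "G (t - Q t) (t - Q t) < 0"
proof -
  obtain t where t: "G t t < 0" using timelike_ex by blast
  have "G t t = G (Q t + (t - Q t)) (Q t + (t - Q t))" by simp
  also have "\<dots> = G (Q t) (Q t) + G (t - Q t) (t - Q t)"
    unfolding G_simps(1,2)
    using projection_orthogonal[OF assms, of t t] by (simp add: G_commute)
  finally have "G (Q t) (Q t) < 0 \<or> G (t - Q t) (t - Q t) < 0" using t by linarith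
  then show thesis using that by blast
qed

text \<open>Two orthogonal unit vectors cannot both be timelike, so the names can be chosen with
  \<open>b\<close> spacelike.\<close>

lemma projection_rank_two:
  assumes P: "projection P" and tr: "op_trace P = 2"
  obtains a b where "G a b = 0" "P a = a" "P b = b" "G a a = 1 \<or> G a a = -1" "G b b = 1"
    "\<And>x. P x = (G a a * G a x) *\<^sub>R a + G b x *\<^sub>R b"
proof -
  obtain S where S: "orthonormal S"
    "\<And>x. P x = (\<Sum>e\<in>S. (G e e * G e x) *\<^sub>R e)" "op_trace P = real (card S)"
    "\<And>e. e \<in> S \<Longrightarrow> P e = e"
    by (rule projection_orthonormal_basis[OF P]) blast
  then have "card S = 2" using tr by simp
  then obtain a b where ab: "S = {a, b}" "a \<noteq> b" by (meson card_2_iff)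
  have o: "G a b = 0" "G b a = 0" "G a a = 1 \<or> G a a = -1" "G b b = 1 \<or> G b b = -1"
    using S(1) ab by (auto simp: orthonormal_def)
  have f: "P a = a" "P b = b" using S(4) ab by auto
  have e: "P x = (G a a * G a x) *\<^sub>R a + (G b b * G b x) *\<^sub>R b" for x
    using S(2)[of x] ab by simp
  show thesis
  proof (cases "G b b = 1")
    case True then show thesis using that[of a b] o f e by simp
  next
    case False
    then have "G b b < 0" using o by auto
    then have "G a a > 0" using reverse[of b a] o by force
    then have "G a a = 1" using o by auto
    then show thesis using that[of b a] o f e by (simp add: add.commute)
  qed
qed

lemma projection_rank_two_timelike:
  assumes P: "projection P" and tr: "op_trace P = 2" and t: "G (P t) (P t) < 0"
  obtains a b where "G a b = 0" "P a = a" "P b = b" "G a a = -1" "G b b = 1"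
    "\<And>x. P x = (- G a x) *\<^sub>R a + G b x *\<^sub>R b"
proof -
  obtain a b where ab: "G a b = 0" "P a = a" "P b = b"
    "G a a = 1 \<or> G a a = -1" "G b b = 1"
    "\<And>x. P x = (G a a * G a x) *\<^sub>R a + G b x *\<^sub>R b" by (rule projection_rank_two[OF P tr]) blast
  have "G a a \<noteq> 1"
  proof
    assume a1: "G a a = 1"
    then have "P t = G a t *\<^sub>R a + G b t *\<^sub>R b" using ab(6)[of t] by simp
    then have "G (P t) (P t) = (G a t)\<^sup>2 + (G b t)\<^sup>2"
      using ab(1,5) a1 G_commute[of b a] by (simp add: power2_eq_square)
    then show False using t sum_power2_ge_zero[of "G a t" "G b t"] by linarith
  qed
  then show thesis using that[of a b] ab by auto
qed

lemma projection_rank_two_spacelike: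
  assumes P: "projection P" and tr: "op_trace P = 2"
    and pos: "\<And>x. P x \<noteq> 0 \<Longrightarrow> G (P x) (P x) > 0"
  obtains a b where "G a b = 0" "P a = a" "P b = b" "G a a = 1" "G b b = 1"
    "\<And>x. P x = G a x *\<^sub>R a + G b x *\<^sub>R b"
proof -
  obtain a b where ab: "G a b = 0" "P a = a" "P b = b"
    "G a a = 1 \<or> G a a = -1" "G b b = 1"
    "\<And>x. P x = (G a a * G a x) *\<^sub>R a + G b x *\<^sub>R b" by (rule projection_rank_two[OF P tr]) blast
  have "G a a = 1" using pos[of a] ab by force
  then show thesis using that[of a b] ab by auto
qed

section \<open>Spectral projections and symmetric operators of square zero\<close>

text \<open>The cubic is \<open>(T - \<xi>) p(T) = 0\<close> with
  \<open>p(X) = X^2 + \<beta> X + \<gamma>\<close>, and \<open>d = p(\<xi>)\<close>. As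
  \<open>\<xi>\<close> is a simple root, \<open>p(T) / d\<close> projects onto its eigenspace.
  Nothing is assumed about the roots of \<open>p\<close>, so \<open>T\<close> may fail to be
  diagonalizable.\<close>

lemma spectral_projection:
  assumes T: "symmetric_op T" and d: "d = \<xi>\<^sup>2 + \<beta> * \<xi> + \<gamma>" "d \<noteq> 0"
    and cubic: "\<And>x. T (T (T x)) + \<beta> *\<^sub>R T (T x) + \<gamma> *\<^sub>R T x
      = \<xi> *\<^sub>R (T (T x) + \<beta> *\<^sub>R T x + \<gamma> *\<^sub>R x)"
    and P: "\<And>x. P x = (1 / d) *\<^sub>R (T (T x) + \<beta> *\<^sub>R T x + \<gamma> *\<^sub>R x)"
  shows "projection P" "T (P x) = \<xi> *\<^sub>R P x" "P (T x) = \<xi> *\<^sub>R P x"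
    "op_trace P = (op_trace (\<lambda>x. T (T x)) + \<beta> * op_trace T + \<gamma> * real CARD('n)) / d"
proof -
  note [simp] = linear_add[OF symmetric_opD(1)[OF T]] linear_scale[OF symmetric_opD(1)[OF T]]
  show TP: "T (P x) = \<xi> *\<^sub>R P x" for x
    using cubic[of x] by (simp add: P flip: scaleR_add_right)
  have comm: "P (T x) = T (P x)" for x by (simp add: P)
  then show "P (T x) = \<xi> *\<^sub>R P x" for x using TP by simp
  have lin: "linear P" by (intro linearI) (auto simp: P algebra_simps)
  have "P (P x) = P x" for x
  proof -
    have "P (P x) = (1 / d) *\<^sub>R (\<xi> *\<^sub>R \<xi> *\<^sub>R P x + \<beta> *\<^sub>R \<xi> *\<^sub>R P x + \<gamma> *\<^sub>R P x)"
      by (subst P) (simp add: TP)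
    also have "\<dots> = (1 / d) *\<^sub>R (d *\<^sub>R P x)"
      by (simp only: d(1) scaleR_add_left scaleR_scaleR power2_eq_square)
    finally show ?thesis using d(2) by simp
  qed
  moreover have "G (P x) y = G x (P y)" for x y
    by (simp add: P symmetric_opD(2)[OF T])
  ultimately show "projection P" using lin by (simp add: projection_def symmetric_op_def)
  have "P = (\<lambda>x. (1 / d) *\<^sub>R (T (T x) + \<beta> *\<^sub>R T x + \<gamma> *\<^sub>R x))" using P by auto
  then show "op_trace P = (op_trace (\<lambda>x. T (T x)) + \<beta> * op_trace T + \<gamma> * real CARD('n)) / d"
    by (simp only: op_trace_simps) simp
qed

text \<open>By symmetry \<open>G (N x) (N y) = G x (N (N y)) = 0\<close>, so the range consists of
  mutually orthogonal null vectors and is a line in Lorentzian signature. Symmetry then makes the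
  coefficient proportional to \<open>G k x\<close>.\<close>

lemma square_zero_symmetric:
  assumes N: "symmetric_op N" and NN: "\<And>x. N (N x) = 0" and nz: "N w \<noteq> 0"
  obtains k c where "k = N w" "G k k = 0" "k \<noteq> 0" "\<And>x. N x = (c * G k x) *\<^sub>R k"
proof -
  define k where "k = N w"
  have o: "G (N x) (N y) = 0" for x y
    using symmetric_opD(2)[OF N, of x "N y"] NN by simp
  have "\<exists>m. N x = m *\<^sub>R k" for x
    using null_orthogonal_parallel[of k "N x"] nz o by (simp add: k_def)
  then obtain \<phi> where \<phi>: "\<And>x. N x = \<phi> x *\<^sub>R k" by metis
  obtain t where t: "G t t < 0" using timelike_ex by blast
  have kt: "G k t \<noteq> 0" using causal_not_orthogonal[OF t] nz o by (simp add: k_def)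
  have "\<phi> x = \<phi> t / G k t * G k x" for x
  proof -
    have "\<phi> x * G k t = \<phi> t * G k x"
      using symmetric_opD(2)[OF N, of x t] unfolding \<phi> by (simp add: G_commute)
    then show ?thesis using kt by (simp add: field_simps)
  qed
  then show thesis using that[of k "\<phi> t / G k t"] \<phi> o nz by (metis k_def)
qed

lemma unit_orthogonal_in_plane:
  assumes "G a a = 1" "G b b = 1" "G a b = 0"
  obtains p q where "G (p *\<^sub>R a + q *\<^sub>R b) (p *\<^sub>R a + q *\<^sub>R b) = 1" "G k (p *\<^sub>R a + q *\<^sub>R b) = 0"
proof (cases "G k a = 0")
  case True
  then show thesis using that[of 1 0] assms by simp
next
  case False
  define m where "m = sqrt ((G k a)\<^sup>2 + (G k b)\<^sup>2)"
  have m: "m > 0" "m * m = (G k a)\<^sup>2 + (G k b)\<^sup>2"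
    using False by (auto simp: m_def sum_power2_gt_zero_iff)
  show thesis
  \<comment> \<open>The components of \<open>k\<close> in the plane are turned by a right angle and
    normalized.\<close>
  proof (rule that[of "G k b / m" "- G k a / m"])
    show "G ((G k b / m) *\<^sub>R a + (- G k a / m) *\<^sub>R b) ((G k b / m) *\<^sub>R a + (- G k a / m) *\<^sub>R b) = 1"
      using m assms G_commute[of b a]
      by (simp add: power2_eq_square flip: add_divide_distrib) (metis False add.commute divide_self_if m(2) mult_eq_0_iff power2_eq_square)
    show "G k ((G k b / m) *\<^sub>R a + (- G k a / m) *\<^sub>R b) = 0" by simp
  qed
qed

text \<open>The vector \<open>?z\<close> is orthogonal to \<open>tau\<close>, so its norm is
  nonnegative. In the expansion of that norm one square term is nonpositive and the other negative,
  which forces the sign of the mixed term.\<close>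

lemma future_product_neg:
  assumes tau: "G tau tau < 0" and e: "future_causal g tau e" "G e e < 0" and k: "future_causal g tau k"
  shows "G k e < 0"
proof -
  let ?z = "G e tau *\<^sub>R k - G k tau *\<^sub>R e"
  have et: "G e tau < 0" "G k tau < 0" "G k k \<le> 0" using e k by (auto simp: future_causal_def)
  have "G tau ?z = 0" by (simp add: G_commute)
  then have "G ?z ?z \<ge> 0" using orthogonal_timelike_nonneg[OF tau] by blast
  also have "G ?z ?z = (G e tau)\<^sup>2 * G k k + (G k tau)\<^sup>2 * G e e - 2 * (G e tau * G k tau) * G k e"
    by (simp add: G_commute[of e k] power2_eq_square algebra_simps)
  finally have "2 * (G e tau * G k tau) * G k e < 0"
    using et e(2) mult_nonneg_nonpos[OF zero_le_power2, of "G k k" "G e tau"]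
      mult_pos_neg[of "(G k tau)\<^sup>2" "G e e"] by (smt (verit) zero_less_power2)
  then show ?thesis using mult_neg_neg[OF et(1,2)] by (smt (verit) mult_nonneg_nonneg)
qed

end

section \<open>The dominant energy condition\<close>

locale dominant_operator = lorentz_space g for g :: "real^'n^'n" +
  fixes tau :: "real^'n" and T :: "real^'n \<Rightarrow> real^'n"
  assumes tau: "gprod g tau tau < 0"
    and symT: "symmetric_op T"
    and dec: "future_causal g tau u \<Longrightarrow> future_causal g tau v \<Longrightarrow> gprod g u (T v) \<ge> 0"
begin

abbreviation future :: "real^'n \<Rightarrow> bool" where "future \<equiv> future_causal g tau"

lemmas linT = symmetric_opD(1)[OF symT]

lemma T_simps [simp]: "T (x + y) = T x + T y" "T (x - y) = T x - T y" "T (- x) = - T x"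
  "T (c *\<^sub>R x) = c *\<^sub>R T x" "T 0 = 0"
  using linT by (simp_all add: linear_add linear_diff linear_neg linear_scale linear_0)

lemma T_sym: "G (T x) y = G x (T y)"
  using symmetric_opD(2)[OF symT] .

lemma future_or_past: "x \<noteq> 0 \<Longrightarrow> G x x \<le> 0 \<Longrightarrow> future x \<or> future (- x)"
  using causal_not_orthogonal[OF tau, of x] by (auto simp: future_causal_def)

lemma futureI:
  assumes "future e" "G e e < 0" "G k k \<le> 0" "G k e < 0" shows "future k"
proof -
  have "k \<noteq> 0" using assms by auto
  then show ?thesis using future_or_past[of k] assms future_product_neg[OF tau, of e "-k"] by auto
qed

text \<open>\<open>T u\<close> has nonnegative product with every future vector. If it were
  spacelike, the future null vector whose part orthogonal to \<open>tau\<close> is opposite to that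
  of \<open>T u\<close> would have a negative product with it.\<close>

lemma causal_image:
  assumes u: "future u" shows "G (T u) (T u) \<le> 0"
proof (rule ccontr)
  assume n: "\<not> ?thesis"
  define w where "w = T u"
  define m where "m = - G tau tau"
  have m: "m > 0" using tau by (simp add: m_def)
  \<comment> \<open>the orthogonal splitting of w with respect to tau, scaled by m to avoid divisions\<close>
  define y where "y = m *\<^sub>R w + G w tau *\<^sub>R tau"
  have yt: "G y tau = 0" by (simp add: y_def m_def)
  have yy: "G y y = m * (m * G w w + (G w tau)\<^sup>2)"
    by (simp add: y_def m_def G_commute[of tau w] power2_eq_square algebra_simps)
  have ypos: "G y y > 0" using n m by (simp add: yy w_def add_pos_nonneg)
  \<comment> \<open>This length makes \<open>l *\<^sub>R tau - y\<close> null.\<close>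
  define l where "l = sqrt (G y y / m)"
  have l: "l > 0" "l * l * m = G y y" using ypos m by (auto simp: l_def)
  define v where "v = l *\<^sub>R tau - y"
  have vt: "G v tau = - l * m" by (simp add: v_def yt m_def)
  have "G v v = - l * l * m + G y y" using yt by (simp add: v_def m_def G_commute[of tau y])
  then have vv: "G v v = 0" using l by simp
  have "future v" using vv vt l m by (auto simp: future_causal_def)
  then have "G v w \<ge> 0" unfolding w_def using dec u by blast
  moreover have "m * G v w = G v y - G w tau * G v tau"
    by (simp add: y_def)
  moreover have "G v y = - G y y" using yt by (simp add: v_def G_commute[of tau y])
  moreover have "m * G v w \<ge> 0" if "G v w \<ge> 0" using that m by simp
  ultimately have "G y y \<le> G w tau * l * m" by (simp add: vt)
  then have "l * (l * m) \<le> l * (G w tau * m)" using l(2) by (simp add: mult_ac)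
  then have "l * m \<le> G w tau * m" using l(1) by simp
  then have le: "l \<le> G w tau" using m by simp
  then have "l * l \<le> (G w tau)\<^sup>2" using l(1) by (simp add: power2_eq_square mult_mono)
  moreover have "l * l = m * G w w + (G w tau)\<^sup>2" using l(2) m by (simp add: yy)
  ultimately have "m * G w w \<le> 0" by simp
  then show False using n m by (simp add: w_def mult_le_0_iff)
qed

text \<open>Rescaling \<open>x\<close> to a vector \<open>y\<close> with
  \<open>G y y = - G u u\<close> makes \<open>u + y\<close> and \<open>u - y\<close> null and, for
  future \<open>u\<close>, future-pointing. The dominant energy condition on the pairs
  \<open>(u + y, u + y)\<close> and \<open>(u + y, u - y)\<close> gives the bound for both signs of
  \<open>s\<close>.\<close>

lemma eigenvalue_bound:
  assumes u: "G u u < 0" and x: "G u x = 0" "x \<noteq> 0" "T x = s *\<^sub>R x"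
  shows "\<bar>s\<bar> * (- G u u) \<le> G u (T u)"
proof -
  have main: "\<bar>s\<bar> * (- G u u) \<le> G u (T u)" if fu: "future u" and u: "G u u < 0" and x1: "G u x = 0" for u
  proof -
    have xx: "G x x > 0" using reverse[OF u x1 x(2)] .
    define y where "y = sqrt (- G u u / G x x) *\<^sub>R x"
    have "G y y = (sqrt (- G u u / G x x))\<^sup>2 * G x x"
      unfolding y_def power2_eq_square G_simps(7,8) by (rule mult.assoc[symmetric])
    then have yy: "G y y = - G u u" using xx u
      by (subst (asm) real_sqrt_pow2) (simp_all add: divide_nonpos_pos)
    have uy: "G u y = 0" "G y u = 0" using x1 by (auto simp: y_def G_commute)
    have Ty: "T y = s *\<^sub>R y" using x(3) by (simp add: y_def)
    have f: "future (u + y)" "future (u - y)"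
      by (rule futureI[OF fu u]; use uy yy u in simp)+
    have uT: "G y (T u) = 0" "G u (T y) = 0" using T_sym[of y u] uy by (auto simp: Ty)
    have "0 \<le> G (u + y) (T (u + y))" "0 \<le> G (u + y) (T (u - y))" using dec f by blast+
    then show ?thesis using uT uy yy by (auto simp: Ty abs_if)
  qed
  have "u \<noteq> 0" using u by auto
  then consider "future u" | "future (- u)" using future_or_past[of u] u by auto
  then show ?thesis
  proof cases
    case 1 then show ?thesis using main u x(1) by blast
  next
    case 2 then show ?thesis using main[of "- u"] u x(1) by simp
  qed
qed

lemma timelike_eigenvalue_nonpos:
  assumes "G e e < 0" "T e = s *\<^sub>R e" shows "s \<le> 0"
proof -
  have "e \<noteq> 0" using assms by auto
  then consider "future e" | "future (- e)" using future_or_past[of e] assms by force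
  then have "G e (T e) \<ge> 0"
  proof cases
    case 1 then show ?thesis using dec by blast
  next
    case 2 then show ?thesis using dec[OF 2 2] by simp
  qed
  then show ?thesis using assms by (simp add: zero_le_mult_iff)
qed

lemma timelike_eigenvalue_dominates:
  assumes "G e e < 0" "T e = \<xi> *\<^sub>R e" "G e x = 0" "x \<noteq> 0" "T x = s *\<^sub>R x"
  shows "\<bar>s\<bar> \<le> - \<xi>"
proof -
  have "\<bar>s\<bar> * (- G e e) \<le> (- \<xi>) * (- G e e)"
    using eigenvalue_bound[OF assms(1,3,4,5)] assms(2) by simp
  then show ?thesis using assms(1) by (simp only: mult_le_cancel_right)
qed

lemma null_eigenvalue_nonpos:
  assumes "G k k = 0" "k \<noteq> 0" "T k = s *\<^sub>R k" shows "s \<le> 0"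
proof -
  have ft: "future tau" using tau by (auto simp: future_causal_def)
  from future_or_past[of k] assms consider "future k" | "future (- k)" by auto
  then show ?thesis
  proof cases
    case 1
    then show ?thesis using dec[OF ft 1] assms(3)
      by (simp add: future_causal_def G_commute[of tau k] zero_le_mult_iff)
  next
    case 2
    then show ?thesis using dec[OF ft 2] assms(3)
      by (simp add: future_causal_def G_commute[of tau k] mult_le_0_iff)
  qed
qed

end

section \<open>Two-forms as skew operators\<close>

lemma mat_mult_vec: "mat c *v x = c *\<^sub>R (x :: real^'n)"
  by (simp add: vec_eq_iff mat_def matrix_vector_mult_def if_distrib[of "\<lambda>z. z * _"] cong: if_cong)

context lorentz_space
begin

lemma g_mult_eq_0: "g *v x = 0 \<Longrightarrow> x = 0"
  using nondegenerate[of x] by (simp add: G_lower)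

lemma matrix_inv_g: "g ** matrix_inv g = mat 1" "matrix_inv g ** g = mat 1"
proof -
  have "invertible g" using g_mult_eq_0 by (simp add: invertible_left_inverse matrix_left_invertible_ker)
  then show "g ** matrix_inv g = mat 1" "matrix_inv g ** g = mat 1"
    unfolding invertible_def matrix_inv_def by (auto intro: someI2_ex)
qed

lemma matrix_inv_g_mult [simp]: "g *v (matrix_inv g *v x) = x" "matrix_inv g *v (g *v x) = x"
  by (simp_all add: matrix_vector_mul_assoc matrix_inv_g)

text \<open>Raising the first index turns a two-form into an operator that is skew for
  \<open>G\<close>.\<close>

definition mixed :: "real^'n^'n \<Rightarrow> real^'n \<Rightarrow> real^'n" where
  "mixed F x = matrix_inv g *v (F *v x)"

lemma linear_mixed: "linear (mixed F)"
  by (intro linearI)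
    (simp_all add: mixed_def matrix_vector_right_distrib matrix_vector_mult_scaleR)

lemma g_mixed: "g *v mixed F x = F *v x"
  by (simp add: mixed_def)

lemma G_mixed: "G (mixed F x) y = (F *v x) \<bullet> y"
  by (simp add: G_lower g_mixed)

lemma mixed_add: "mixed (F + F') x = mixed F x + mixed F' x"
  by (simp add: mixed_def matrix_vector_mult_add_rdistrib matrix_vector_right_distrib)

lemma mixed_inject: "mixed F = mixed F' \<Longrightarrow> F = F'"
  by (metis g_mixed matrix_eq)

lemma mixed_skew:
  assumes "two_form F" shows "G (mixed F x) y = - G x (mixed F y)"
proof -
  have "G (mixed F x) y = (transpose F *v y) \<bullet> x"
    by (metis G_mixed dot_lmul_matrix inner_commute transpose_matrix_vector)
  moreover have "(- F) *v y = - (F *v y)"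
    by (simp add: vec_eq_iff matrix_vector_mult_def sum_negf)
  ultimately show ?thesis using assms
    by (simp add: two_form_def G_commute[of x] G_mixed del: transpose_matrix_vector)
qed

text \<open>With \<open>A = mixed F\<close>, antisymmetry of the second factor gives
  \<open>F^{ac} F_{bc} = -(A^2)^a_b\<close> and \<open>F^{cd} F_{cd} = -[A^2]\<close>.\<close>

lemma superenergy_apply:
  assumes "two_form F"
  shows "superenergy g F *v x
    = (op_trace (\<lambda>x. mixed F (mixed F x)) / 4) *\<^sub>R x - mixed F (mixed F x)"
proof -
  have F: "F $ b $ c = - F $ c $ b" for b c
  proof -
    have "transpose F $ b $ c = - F $ b $ c" using assms by (simp add: two_form_def)
    then show ?thesis by (simp add: transpose_def)
  qed
  define M where "M = matrix_inv g ** F ** (matrix_inv g ** F)"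
  have r: "(\<Sum>c\<in>UNIV. raise2 g F $ a $ c * F $ b $ c) = - M $ a $ b" for a b
  proof -
    have "M = raise2 g F ** F" by (simp add: M_def raise2_def matrix_mul_assoc)
    then show ?thesis by (subst F) (simp add: matrix_matrix_mult_def sum_negf)
  qed
  have tr: "(\<Sum>c\<in>UNIV. \<Sum>d\<in>UNIV. raise2 g F $ c $ d * F $ c $ d) = - trace M"
    by (simp add: r trace_def sum_negf)
  have M: "M *v y = mixed F (mixed F y)" for y
    by (simp add: M_def mixed_def matrix_vector_mul_assoc matrix_mul_assoc)
  have "superenergy g F = mat (trace M / 4) - M"
    unfolding superenergy_def tr unfolding r by (simp add: vec_eq_iff mat_def)
  then have "superenergy g F *v x = mat (trace M / 4) *v x - M *v x"
    by (simp add: matrix_vector_mult_diff_rdistrib)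
  then show ?thesis using op_trace_matrix[of M] by (simp add: M mat_mult_vec)
qed

section \<open>Simple two-forms and the decomposition of a two-form\<close>

lemma wedge_apply: "wedge g u v *v x = (G v x / 2) *\<^sub>R (g *v u) - (G u x / 2) *\<^sub>R (g *v v)"
proof -
  define U V where "U = g *v u" and "V = g *v v"
  have "(wedge g u v *v x) $ i = (V \<bullet> x / 2) * U $ i - (U \<bullet> x / 2) * V $ i" for i
  proof -
    have "(wedge g u v *v x) $ i
        = (\<Sum>j\<in>UNIV. (U $ i / 2) * (V $ j * x $ j) - (V $ i / 2) * (U $ j * x $ j))"
      by (simp add: wedge_def matrix_vector_mult_def[of "vec_lambda _"] flip: U_def V_def)
        (rule sum.cong, simp_all add: field_simps)
    also have "\<dots> = (V \<bullet> x / 2) * U $ i - (U \<bullet> x / 2) * V $ i"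
      by (simp only: sum_subtractf inner_vec_def sum_distrib_left[symmetric] inner_real_def) (simp add: field_simps)
    finally show ?thesis .
  qed
  then show ?thesis by (simp add: vec_eq_iff G_lower U_def V_def)
qed

lemma mixed_wedge: "mixed (wedge g u v) x = (G v x / 2) *\<^sub>R u - (G u x / 2) *\<^sub>R v"
  by (simp add: mixed_def wedge_apply matrix_vector_mult_diff_distrib matrix_vector_mult_scaleR)

lemma two_form_wedge: "two_form (wedge g u v)"
  by (simp add: two_form_def wedge_def transpose_def vec_eq_iff field_simps)

lemma two_form_add: "two_form F \<Longrightarrow> two_form F' \<Longrightarrow> two_form (F + F')"
  and two_form_diff: "two_form F \<Longrightarrow> two_form F' \<Longrightarrow> two_form (F - F')"
proof -
  have "transpose (F + F') = transpose F + transpose F'" "transpose (F - F') = transpose F - transpose F'"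
    by (simp_all add: transpose_def vec_eq_iff)
  then show "two_form F \<Longrightarrow> two_form F' \<Longrightarrow> two_form (F + F')"
    "two_form F \<Longrightarrow> two_form F' \<Longrightarrow> two_form (F - F')"
    by (simp_all add: two_form_def)
qed

lemma form_rank_two_wedges: "form_rank (wedge g u v + wedge g u' v') \<le> 4"
proof -
  let ?S = "{g *v u, g *v v, g *v u', g *v v'}"
  have "range (\<lambda>x. (wedge g u v + wedge g u' v') *v x) \<subseteq> span ?S"
  proof (rule image_subsetI)
    fix x
    have "(G v x / 2) *\<^sub>R (g *v u) \<in> span ?S" "(G u x / 2) *\<^sub>R (g *v v) \<in> span ?S"
      "(G v' x / 2) *\<^sub>R (g *v u') \<in> span ?S" "(G u' x / 2) *\<^sub>R (g *v v') \<in> span ?S"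
      by (simp_all add: span_scale span_base)
    then show "(wedge g u v + wedge g u' v') *v x \<in> span ?S"
      by (simp add: matrix_vector_mult_add_rdistrib wedge_apply span_add span_diff)
  qed
  then have "form_rank (wedge g u v + wedge g u' v') \<le> card ?S"
    unfolding form_rank_def by (rule dim_le_card) simp
  also have "\<dots> \<le> 4" using card_length[of "[g *v u, g *v v, g *v u', g *v v']"] by simp
  finally show ?thesis .
qed

text \<open>One step of the symplectic Gram-Schmidt process: if
  \<open>u \<bullet> (F *v v) = 1\<close>, subtracting a suitable simple form built from
  \<open>F *v u\<close> and \<open>F *v v\<close> leaves a form whose range annihilates
  \<open>u\<close> and \<open>v\<close>, and the rank drops by at least two. For
  \<open>F = 0\<close> the difference of naturals is 0.\<close>

lemma two_form_split_wedge:
  assumes "two_form F"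
  obtains p q where "p \<in> range (mixed F)" "q \<in> range (mixed F)"
    "range ((*v) (F - wedge g p q)) \<subseteq> range ((*v) F)"
    "form_rank (F - wedge g p q) \<le> form_rank F - 2"
proof (cases "F = 0")
  case True
  have "wedge g 0 0 = 0" by (simp add: wedge_def vec_eq_iff)
  moreover have "0 \<in> range (mixed F)" by (rule range_eqI[of _ _ 0]) (simp add: mixed_def)
  moreover have "form_rank (0 :: real^'n^'n) = 0" by (simp add: form_rank_def)
  ultimately show thesis using that[of 0 0] True by simp
next
  case False
  have sk: "x \<bullet> (F *v y) = - (y \<bullet> (F *v x))" for x y
    using mixed_skew[OF assms, of y x] by (simp add: G_commute[of y] G_mixed inner_commute)
  from False obtain y where "F *v y \<noteq> 0" by (metis matrix_eq matrix_vector_mult_0)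
  then have nz: "(F *v y) \<bullet> (F *v y) \<noteq> 0" by simp
  define v where "v = y"
  define u where "u = (1 / ((F *v y) \<bullet> (F *v y))) *\<^sub>R (F *v y)"
  have uv: "u \<bullet> (F *v v) = 1" using nz by (simp add: u_def v_def)
  have vu: "v \<bullet> (F *v u) = - 1" using sk[of v u] uv by simp
  have uu: "x \<bullet> (F *v x) = 0" for x using sk[of x x] by simp
  \<comment> \<open>The factor 2 cancels the 1/2 in \<open>wedge\<close>.\<close>
  define p where "p = mixed F (2 *\<^sub>R u)"
  define q where "q = mixed F v"
  define F' where "F' = F - wedge g p q"
  have F': "F' *v z = F *v z + (v \<bullet> (F *v z)) *\<^sub>R (F *v u) - (u \<bullet> (F *v z)) *\<^sub>R (F *v v)" for z
  proof -
    have "G q z = - (v \<bullet> (F *v z))" "G p z = - 2 * (u \<bullet> (F *v z))"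
      using sk[of z v] sk[of z u]
      by (simp_all add: p_def q_def G_mixed inner_commute matrix_vector_mult_scaleR)
    then show ?thesis
      by (simp add: F'_def p_def q_def matrix_vector_mult_diff_rdistrib wedge_apply g_mixed matrix_vector_mult_scaleR)
  qed
  have perp: "u \<bullet> (F' *v z) = 0" "v \<bullet> (F' *v z) = 0" for z
    using uv vu uu by (simp_all add: F' inner_simps)
  have sub: "range ((*v) F') \<subseteq> range ((*v) F)"
  proof
    fix w assume "w \<in> range ((*v) F')"
    then obtain z where "w = F' *v z" by blast
    then have "w = F *v (z + (v \<bullet> (F *v z)) *\<^sub>R u - (u \<bullet> (F *v z)) *\<^sub>R v)"
      by (simp add: F' matrix_vector_right_distrib matrix_vector_mult_diff_distrib matrix_vector_mult_scaleR)
    then show "w \<in> range ((*v) F)" by blast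
  qed
  let ?R = "range ((*v) F')"
  \<comment> \<open>All covectors in the range of \<open>F'\<close> annihilate \<open>u\<close> and
    \<open>v\<close>. As \<open>F *v v\<close> does not annihilate \<open>u\<close>, and
    \<open>F *v u\<close> does not annihilate \<open>v\<close> while \<open>F *v v\<close> does,
    both are new dimensions.\<close>
  have 1: "x \<bullet> u = 0 \<and> x \<bullet> v = 0" if "x \<in> span ?R" for x
    using that by (induction rule: span_induct_alt) (use perp in \<open>auto simp: inner_simps inner_commute\<close>)
  have 2: "x \<bullet> v = 0" if "x \<in> span (insert (F *v v) ?R)" for x
    using that by (induction rule: span_induct_alt) (use perp uu in \<open>auto simp: inner_simps inner_commute\<close>)
  have "F *v v \<notin> span ?R" using 1[of "F *v v"] uv by (auto simp: inner_commute)
  moreover have "F *v u \<notin> span (insert (F *v v) ?R)" using 2[of "F *v u"] vu by (auto simp: inner_commute)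
  ultimately have "dim (insert (F *v u) (insert (F *v v) ?R)) = dim ?R + 2"
    by (simp add: dim_insert)
  moreover have "dim (insert (F *v u) (insert (F *v v) ?R)) \<le> dim (range ((*v) F))"
    using sub by (intro dim_subset) auto
  ultimately have "form_rank F' \<le> form_rank F - 2" by (simp add: form_rank_def)
  then show thesis using that[of p q] sub by (simp add: p_def q_def F'_def)
qed

text \<open>Two splitting steps exhaust the form. That the four vectors lie in the range of
  \<open>mixed F\<close> later determines the causal type of the summands.\<close>

lemma two_form_rank_four_wedges:
  assumes "two_form F" "form_rank F \<le> 4"
  obtains a b c d where "F = wedge g a b + wedge g c d" "{a, b, c, d} \<subseteq> range (mixed F)"
proof -
  obtain a b where ab: "a \<in> range (mixed F)" "b \<in> range (mixed F)"
    "range ((*v) (F - wedge g a b)) \<subseteq> range ((*v) F)"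
    "form_rank (F - wedge g a b) \<le> form_rank F - 2"
    by (rule two_form_split_wedge[OF assms(1)]) blast
  let ?F = "F - wedge g a b"
  have F: "two_form ?F" using assms two_form_wedge two_form_diff by blast
  obtain c d where cd: "c \<in> range (mixed ?F)" "d \<in> range (mixed ?F)"
    "form_rank (?F - wedge g c d) \<le> form_rank ?F - 2"
    by (rule two_form_split_wedge[OF F]) blast
  have "form_rank (?F - wedge g c d) = 0" using cd ab assms by linarith
  then have "range ((*v) (?F - wedge g c d)) \<subseteq> {0}" by (simp add: form_rank_def)
  then have "?F - wedge g c d = 0" by (subst matrix_eq) auto
  then have "F = wedge g a b + wedge g c d" by (simp add: algebra_simps)
  moreover have "range (mixed ?F) \<subseteq> range (mixed F)" 
  proof
    fix z assume "z \<in> range (mixed ?F)"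
    then obtain x where "z = matrix_inv g *v (?F *v x)" unfolding mixed_def by blast
    moreover obtain y where "?F *v x = F *v y" using ab(3) by blast
    ultimately have "z = mixed F y" by (simp add: mixed_def)
    then show "z \<in> range (mixed F)" by blast
  qed
  ultimately show thesis using that ab cd by blast
qed

text \<open>On the span of \<open>a, b, c, d\<close> the operator \<open>A\<close> is \<open>J\<close> times the Gram matrix \<open>M\<close>, with \<open>J\<close> the standard
  symplectic matrix. As \<open>J M J M J\<close> is skew, only six coefficients occur in the square of \<open>A\<close>.\<close>

lemma rank_four_square:
  assumes A: "\<And>x. A x = G b x *\<^sub>R a - G a x *\<^sub>R b + G d x *\<^sub>R c - G c x *\<^sub>R d"
  defines "p \<equiv> G a b * G a b - G a a * G b b + G a d * G b c - G a c * G b d"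
    and "w \<equiv> G b c * G a d - G a c * G b d + G c d * G c d - G c c * G d d"
    and "e \<equiv> G a b * G a d - G a a * G b d + G a d * G c d - G a c * G d d"
    and "f \<equiv> G a a * G b c - G a b * G a c - G a d * G c c + G a c * G c d"
    and "h \<equiv> G b b * G a d - G a b * G b d + G b d * G c d - G b c * G d d"
    and "i \<equiv> G a b * G b c - G b b * G a c - G b d * G c c + G b c * G c d"
  shows "A (A a) = p *\<^sub>R a + e *\<^sub>R c + f *\<^sub>R d" "A (A b) = p *\<^sub>R b + h *\<^sub>R c + i *\<^sub>R d"
    "A (A c) = i *\<^sub>R a - f *\<^sub>R b + w *\<^sub>R c" "A (A d) = e *\<^sub>R b - h *\<^sub>R a + w *\<^sub>R d"
proof -
  have lin: "linear A" by (intro linearI) (simp_all add: A algebra_simps)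
  note lA = linear_add[OF lin] linear_diff[OF lin] linear_scale[OF lin]
  note comm = G_commute[of b a] G_commute[of c a] G_commute[of d a] G_commute[of c b]
    G_commute[of d b] G_commute[of d c]
  have 1: "A a = G a b *\<^sub>R a - G a a *\<^sub>R b + G a d *\<^sub>R c - G a c *\<^sub>R d"
    "A b = G b b *\<^sub>R a - G a b *\<^sub>R b + G b d *\<^sub>R c - G b c *\<^sub>R d"
    "A c = G b c *\<^sub>R a - G a c *\<^sub>R b + G c d *\<^sub>R c - G c c *\<^sub>R d"
    "A d = G b d *\<^sub>R a - G a d *\<^sub>R b + G d d *\<^sub>R c - G c d *\<^sub>R d"
    by (simp_all only: A comm)
  show "A (A a) = p *\<^sub>R a + e *\<^sub>R c + f *\<^sub>R d"
    by (simp only: 1 lA) (simp add: p_def e_def f_def algebra_simps)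
  show "A (A b) = p *\<^sub>R b + h *\<^sub>R c + i *\<^sub>R d"
    by (simp only: 1 lA) (simp add: p_def h_def i_def algebra_simps)
  show "A (A c) = i *\<^sub>R a - f *\<^sub>R b + w *\<^sub>R c"
    by (simp only: 1 lA) (simp add: i_def f_def w_def algebra_simps)
  show "A (A d) = e *\<^sub>R b - h *\<^sub>R a + w *\<^sub>R d"
    by (simp only: 1 lA) (simp add: e_def h_def w_def algebra_simps)
qed

text \<open>Cayley-Hamilton for a skew operator with eigenvalues \<open>\<lambda>\<close>,
  \<open>-\<lambda>\<close>, \<open>\<mu>\<close>, \<open>-\<mu>\<close> besides zero:
  \<open>\<alpha> = \<lambda>^2 + \<mu>^2\<close> and \<open>\<beta> = \<lambda>^2 \<mu>^2\<close>,
  both expressed by traces. The quartic relation is checked on \<open>a\<close>, \<open>b\<close>,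
  \<open>c\<close>, \<open>d\<close>, of which \<open>A x\<close> is a combination.\<close>

lemma rank_four_quintic:
  fixes a b c d :: "real^'n" and A
  assumes A: "\<And>x. A x = G b x *\<^sub>R a - G a x *\<^sub>R b + G d x *\<^sub>R c - G c x *\<^sub>R d"
  defines "\<alpha> \<equiv> op_trace (\<lambda>x. A (A x)) / 2"
  defines "\<beta> \<equiv> (2 * \<alpha>\<^sup>2 - op_trace (\<lambda>x. A (A (A (A x))))) / 4"
  shows "A (A (A (A (A x)))) = \<alpha> *\<^sub>R A (A (A x)) - \<beta> *\<^sub>R A x"
proof -
  have lin: "linear A" by (intro linearI) (auto simp: A algebra_simps)
  note lA [simp] = linear_add[OF lin] linear_diff[OF lin] linear_scale[OF lin]
  define p where "p = G a b * G a b - G a a * G b b + G a d * G b c - G a c * G b d"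
  define w where "w = G b c * G a d - G a c * G b d + G c d * G c d - G c c * G d d"
  define e where "e = G a b * G a d - G a a * G b d + G a d * G c d - G a c * G d d"
  define f where "f = G a a * G b c - G a b * G a c - G a d * G c c + G a c * G c d"
  define h where "h = G b b * G a d - G a b * G b d + G b d * G c d - G b c * G d d"
  define i where "i = G a b * G b c - G b b * G a c - G b d * G c c + G b c * G c d"
  note sq = rank_four_square[where A = A, OF A, folded p_def w_def e_def f_def h_def i_def]
  note comm = G_commute[of b a] G_commute[of c a] G_commute[of d a] G_commute[of c b]
    G_commute[of d b] G_commute[of d c]
  have v: "G b (A a) = p" "G a (A b) = - p" "G d (A c) = w" "G c (A d) = - w"
    "G b (A c) = i" "G b (A d) = - h" "G a (A c) = f" "G a (A d) = - e"
    "G d (A a) = e" "G d (A b) = h" "G c (A a) = - f" "G c (A b) = - i"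
    by (simp_all add: A[of a] A[of b] A[of c] A[of d] p_def w_def e_def f_def h_def i_def comm algebra_simps)
  \<comment> \<open>Expanding only the innermost \<open>A\<close> writes the power as a sum of
    rank-one maps with evident traces.\<close>
  have A2: "(\<lambda>x. A (A x)) = (\<lambda>x. G b x *\<^sub>R A a - G a x *\<^sub>R A b + G d x *\<^sub>R A c - G c x *\<^sub>R A d)"
    by (rule ext, subst (2) A) simp
  have A4: "(\<lambda>x. A (A (A (A x)))) = (\<lambda>x. G b x *\<^sub>R A (A (A a)) - G a x *\<^sub>R A (A (A b))
      + G d x *\<^sub>R A (A (A c)) - G c x *\<^sub>R A (A (A d)))"
    by (rule ext, subst (4) A) simp
  have t2: "\<alpha> = p + w"
    unfolding \<alpha>_def A2 op_trace_add op_trace_diff op_trace_G by (simp add: v)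
  have t4: "op_trace (\<lambda>x. A (A (A (A x)))) = 2 * (p * p + e * i - f * h) + 2 * (w * w + e * i - f * h)"
    unfolding A4 op_trace_add op_trace_diff op_trace_G by (simp add: sq v algebra_simps)
  have \<beta>: "\<beta> = p * w - e * i + f * h"
    unfolding \<beta>_def t2 t4 by (simp add: power2_eq_square field_simps)
  have b1: "A (A (A (A a))) = \<alpha> *\<^sub>R A (A a) - \<beta> *\<^sub>R a"
    and b2: "A (A (A (A b))) = \<alpha> *\<^sub>R A (A b) - \<beta> *\<^sub>R b"
    and b3: "A (A (A (A c))) = \<alpha> *\<^sub>R A (A c) - \<beta> *\<^sub>R c"
    and b4: "A (A (A (A d))) = \<alpha> *\<^sub>R A (A d) - \<beta> *\<^sub>R d"
    by (simp_all only: sq t2 \<beta> lA) (simp_all add: algebra_simps)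
  show ?thesis
    by (simp only: A[of x] lA b1 b2 b3 b4) (simp add: algebra_simps)
qed

end

section \<open>Superenergy tensors satisfy both conditions\<close>

text \<open>Nonzero singular values of a skew matrix occur in pairs, so the squared operator norm is
  at most half the squared Frobenius norm. This bounds the magnetic part in the energy
  estimate.\<close>

lemma skew_apply_bound:
  fixes B :: "'a \<Rightarrow> 'a \<Rightarrow> real"
  assumes fin: "finite S" and skew: "\<And>e f. e \<in> S \<Longrightarrow> f \<in> S \<Longrightarrow> B e f = - B f e"
    and z: "\<And>e. e \<in> S \<Longrightarrow> z e = (\<Sum>f\<in>S. B e f * y f)"
  shows "2 * (\<Sum>e\<in>S. (z e)\<^sup>2) \<le> (\<Sum>e\<in>S. \<Sum>f\<in>S. (B e f)\<^sup>2) * (\<Sum>e\<in>S. (y e)\<^sup>2)"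
proof -
  define Y where "Y = (\<Sum>e\<in>S. (y e)\<^sup>2)"
  define Z where "Z = (\<Sum>e\<in>S. (z e)\<^sup>2)"
  define N where "N = (\<Sum>e\<in>S. \<Sum>f\<in>S. (B e f)\<^sup>2)"
  have Y0: "Y \<ge> 0" by (simp add: Y_def sum_nonneg)
  have c1: "(\<Sum>e\<in>S. \<Sum>f\<in>S. z e * (B e f * y f)) = Z"
    by (simp add: Z_def power2_eq_square z flip: sum_distrib_left)
  have c2: "(\<Sum>e\<in>S. \<Sum>f\<in>S. y e * (B e f * z f)) = - Z"
  proof -
    have "(\<Sum>e\<in>S. \<Sum>f\<in>S. y e * (B e f * z f)) = (\<Sum>f\<in>S. \<Sum>e\<in>S. y e * (B e f * z f))"
      by (rule sum.swap)
    also have "\<dots> = (\<Sum>f\<in>S. \<Sum>e\<in>S. - (z f * (B f e * y e)))"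
    proof (intro sum.cong refl)
      fix e f assume "f \<in> S" "e \<in> S"
      then have "B e f = - B f e" using skew by blast
      then show "y e * (B e f * z f) = - (z f * (B f e * y e))" by simp
    qed
    finally show ?thesis using c1 by (simp add: sum_negf)
  qed
  \<comment> \<open>removing from \<open>B\<close> its part in the plane of \<open>y\<close> and \<open>z\<close> leaves a nonnegative Frobenius norm\<close>
  have "0 \<le> (\<Sum>e\<in>S. \<Sum>f\<in>S. (Y * B e f - z e * y f + y e * z f)\<^sup>2)"
    by (intro sum_nonneg) simp
  also have "\<dots> = (\<Sum>e\<in>S. \<Sum>f\<in>S. Y\<^sup>2 * (B e f)\<^sup>2 + (z e)\<^sup>2 * (y f)\<^sup>2 + (y e)\<^sup>2 * (z f)\<^sup>2
      - (2 * Y) * (z e * (B e f * y f)) + (2 * Y) * (y e * (B e f * z f))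
      - 2 * ((z e * y e) * (z f * y f)))"
    by (intro sum.cong refl) (simp add: power2_eq_square algebra_simps)
  also have "\<dots> = Y\<^sup>2 * N + Z * Y + Y * Z - (2 * Y) * Z + (2 * Y) * (- Z)
      - 2 * ((\<Sum>e\<in>S. z e * y e) * (\<Sum>f\<in>S. z f * y f))"
    unfolding sum.distrib sum_subtractf sum_distrib_left[symmetric] sum_distrib_right[symmetric]
      c1[unfolded sum_distrib_left[symmetric]] c2[unfolded sum_distrib_left[symmetric]]
    by (simp add: Y_def Z_def N_def)
  also have "\<dots> \<le> Y * (Y * N - 2 * Z)"
    by (simp add: algebra_simps power2_eq_square)
  finally have main: "0 \<le> Y * (Y * N - 2 * Z)" .
  show ?thesis
  proof (cases "Y = 0")
    case True
    then have "y e = 0" if "e \<in> S" for e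
      using that fin by (simp add: Y_def sum_nonneg_eq_0_iff)
    then have "z e = 0" if "e \<in> S" for e using z[OF that] by simp
    then have "Z = 0" by (simp add: Z_def)
    then show ?thesis using True by (simp add: Y_def Z_def)
  next
    case False
    then have "0 \<le> Y * N - 2 * Z" using main Y0 by (simp add: zero_le_mult_iff)
    then show ?thesis by (simp add: Y_def Z_def N_def mult.commute)
  qed
qed

section \<open>The energy estimate for skew operators\<close>

context lorentz_space
begin

text \<open>The left side is \<open>G u (T v)\<close> for \<open>T = [A^2]/4 - A^2\<close>. Write
  \<open>v = \<alpha> u + y\<close> with \<open>y\<close> orthogonal to \<open>u\<close>, and let
  \<open>z\<close> be the part of \<open>A y\<close> orthogonal to \<open>u\<close>. Then
  \<open>2 \<alpha>\<close> times the left side is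
  \<open>\<alpha>^2 E + 2 \<alpha> G (A u) z + \<alpha>^2 N / 2\<close>, which is at least the norm
  of the spatial vector \<open>\<alpha> A u + z\<close>, because
  \<open>2 G z z \<le> N \<alpha>^2\<close>.\<close>

lemma skew_energy_unit:
  assumes lin: "linear A" and skew: "\<And>x y. G (A x) y = - G x (A y)"
    and u: "G u u = -1" and v: "G v v \<le> 0" "G u v < 0"
  shows "G (A u) (A v) + op_trace (\<lambda>x. A (A x)) / 4 * G u v \<ge> 0"
proof -
  \<comment> \<open>\<open>P\<close> projects onto the orthogonal complement of the unit timelike
    \<open>u\<close>, on which \<open>G\<close> is Euclidean.\<close>
  define P where "P x = x + G u x *\<^sub>R u" for x
  have "projection P" unfolding projection_def symmetric_op_def
  proof (intro conjI allI)
    show "linear P" by (intro linearI) (simp_all add: P_def algebra_simps)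
    show "G (P x) y = G x (P y)" for x y by (simp add: P_def G_commute[of x u])
    show "P (P x) = P x" for x using u by (simp add: P_def algebra_simps)
  qed
  then obtain S where S: "orthonormal S" and PS: "\<And>x. P x = (\<Sum>e\<in>S. (G e e * G e x) *\<^sub>R e)"
    and fix_S: "\<And>e. e \<in> S \<Longrightarrow> P e = e"
    by (rule projection_orthonormal_basis) blast
  have fin: "finite S" using S by (simp add: orthonormal_def)
  have unit: "G e e = 1" if e: "e \<in> S" for e
  proof -
    have e1: "G e e = 1 \<or> G e e = -1" using S e by (simp add: orthonormal_def)
    then have "e \<noteq> 0" by auto
    moreover have "u \<noteq> 0" using u by auto
    ultimately have "G u e = 0" using fix_S[OF e] by (simp add: P_def)
    then have "G e e > 0" using reverse[of u e] u \<open>e \<noteq> 0\<close> by simp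
    then show ?thesis using e1 by auto
  qed
  have PS: "P x = (\<Sum>e\<in>S. G e x *\<^sub>R e)" for x
    unfolding PS by (rule sum.cong) (simp_all add: unit)
  have expand: "x = (\<Sum>e\<in>S. G e x *\<^sub>R e) - G u x *\<^sub>R u" for x
    using PS[of x] by (simp add: P_def algebra_simps)
  have parseval: "G x y = (\<Sum>e\<in>S. G e x * G e y) - G u x * G u y" for x y
    by (subst (1) expand[of x]) (simp add: G_sum_left)
  have tr: "op_trace f = (\<Sum>e\<in>S. G e (f e)) - G u (f u)" if f: "linear f" for f
  proof -
    have "f = (\<lambda>x. (\<Sum>e\<in>S. G e x *\<^sub>R f e) - G u x *\<^sub>R f u)"
    proof
      fix x show "f x = (\<Sum>e\<in>S. G e x *\<^sub>R f e) - G u x *\<^sub>R f u"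
        by (subst (1) expand[of x]) (simp add: linear_diff[OF f] linear_sum[OF f] linear_scale[OF f])
    qed
    then have "op_trace f = op_trace (\<lambda>x. (\<Sum>e\<in>S. G e x *\<^sub>R f e) - G u x *\<^sub>R f u)" by simp
    then show ?thesis by (simp only: op_trace_diff op_trace_sum op_trace_G)
  qed
  have self: "G x (A x) = 0" for x using skew[of x x] by (simp add: G_commute)
  \<comment> \<open>\<open>E\<close> is the squared electric field seen by \<open>u\<close>, and
    \<open>N\<close> the squared Frobenius norm of the magnetic part; the invariant
    \<open>[A^2]\<close> is \<open>2 E - N\<close>.\<close>
  define E where "E = G (A u) (A u)"
  define N where "N = (\<Sum>e\<in>S. \<Sum>f\<in>S. (G e (A f))\<^sup>2)"
  have E: "E = (\<Sum>e\<in>S. (G u (A e))\<^sup>2)"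
  proof -
    have "E = (\<Sum>e\<in>S. (G e (A u))\<^sup>2)"
      unfolding E_def parseval[of "A u" "A u"] by (simp add: self power2_eq_square)
    moreover have "G e (A u) = - G u (A e)" for e using skew[of e u] by (simp add: G_commute)
    ultimately show ?thesis by simp
  qed
  have "(\<Sum>e\<in>S. G (A e) (A e)) = (\<Sum>e\<in>S. (\<Sum>f\<in>S. (G f (A e))\<^sup>2) - (G u (A e))\<^sup>2)"
    by (rule sum.cong) (simp_all add: parseval[of "A _" "A _"] power2_eq_square)
  also have "\<dots> = N - E"
    unfolding sum_subtractf E N_def by (subst sum.swap) simp
  finally have Ae: "(\<Sum>e\<in>S. G (A e) (A e)) = N - E" .
  have "linear (\<lambda>x. A (A x))" using linear_compose[OF lin lin] by (simp add: o_def)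
  then have "op_trace (\<lambda>x. A (A x)) = (\<Sum>e\<in>S. - G (A e) (A e)) + E"
    using tr by (simp add: skew E_def)
  then have trA: "op_trace (\<lambda>x. A (A x)) = 2 * E - N" using Ae by (simp add: sum_negf)
  define \<alpha> where "\<alpha> = - G u v"
  define y where "y = P v"
  have \<alpha>: "\<alpha> > 0" using v by (simp add: \<alpha>_def)
  have vy: "v = \<alpha> *\<^sub>R u + y" by (simp add: y_def P_def \<alpha>_def)
  have uy: "G u y = 0" using u by (simp add: y_def P_def)
  have yu: "G y u = 0" using uy by (simp add: G_commute)
  have yy: "G y y \<le> \<alpha>\<^sup>2" using v(1) u unfolding vy by (simp add: uy yu power2_eq_square)
  have ye: "G y y = (\<Sum>e\<in>S. (G e y)\<^sup>2)" using parseval[of y y] uy by (simp add: power2_eq_square)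
  define z where "z = P (A y)"
  have uz: "G u z = 0" using u by (simp add: z_def P_def)
  have Gez: "G e z = (\<Sum>f\<in>S. G e (A f) * G f y)" if "e \<in> S" for e
  proof -
    have "G e u = 0" using fix_S[OF that] u by (auto simp: P_def G_commute)
    then have "G e z = G e (A y)" by (simp add: z_def P_def)
    moreover have y: "y = (\<Sum>f\<in>S. G f y *\<^sub>R f)" using expand[of y] uy by simp
    have "A y = (\<Sum>f\<in>S. G f y *\<^sub>R A f)"
      using arg_cong[OF y, of A] by (simp add: linear_sum[OF lin] linear_scale[OF lin])
    ultimately show ?thesis by (simp add: G_sum_right mult.commute)
  qed
  have skew': "G e (A f) = - G f (A e)" for e f using skew[of e f] G_commute[of "A e" f] by simp
  have "G z z = (\<Sum>e\<in>S. (G e z)\<^sup>2)" using parseval[of z z] uz by (simp add: power2_eq_square)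
  then have "2 * G z z \<le> N * G y y"
    unfolding ye N_def
    using skew_apply_bound[OF fin, of "\<lambda>e f. G e (A f)" "\<lambda>e. G e z" "\<lambda>e. G e y", OF skew' Gez]
    by simp
  moreover have "N \<ge> 0" by (simp add: N_def sum_nonneg)
  ultimately have zz: "2 * G z z \<le> N * \<alpha>\<^sup>2" using yy mult_left_mono[OF yy, of N] by linarith
  have ut: "G u u < 0" using u by simp
  have "G u (\<alpha> *\<^sub>R A u + z) = 0" by (simp add: self uz)
  then have "0 \<le> G (\<alpha> *\<^sub>R A u + z) (\<alpha> *\<^sub>R A u + z)"
    by (rule orthogonal_timelike_nonneg[OF ut])
  also have "\<dots> = \<alpha>\<^sup>2 * E + 2 * \<alpha> * G (A u) z + G z z"
    by (simp add: E_def power2_eq_square G_commute[of z "A u"] algebra_simps)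
  finally have pos: "0 \<le> \<alpha>\<^sup>2 * E + 2 * \<alpha> * G (A u) z + G z z" .
  have Auz: "G (A u) (A y) = G (A u) z"
    by (simp add: z_def P_def G_commute[of "A u" u] self)
  have "G (A u) (A v) + op_trace (\<lambda>x. A (A x)) / 4 * G u v = \<alpha> * E / 2 + \<alpha> * N / 4 + G (A u) z"
    unfolding vy trA using u uy Auz
    by (simp add: linear_add[OF lin] linear_scale[OF lin] E_def field_simps)
  also have "2 * \<alpha> * \<dots> = \<alpha>\<^sup>2 * E + 2 * \<alpha> * G (A u) z + \<alpha>\<^sup>2 * N / 2"
    by (simp add: power2_eq_square field_simps)
  moreover have "0 \<le> \<alpha>\<^sup>2 * E + 2 * \<alpha> * G (A u) z + \<alpha>\<^sup>2 * N / 2" using pos zz by (simp add: mult.commute)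
  ultimately have "0 \<le> 2 * \<alpha> * (G (A u) (A v) + op_trace (\<lambda>x. A (A x)) / 4 * G u v)" by simp
  then show ?thesis using \<alpha> by (simp add: zero_le_mult_iff)
qed

text \<open>By homogeneity a timelike \<open>u\<close> may be normalized. A causal \<open>u\<close>
  is the limit of the timelike vectors \<open>u + \<epsilon> tau\<close>, and the inequality is
  linear in \<open>u\<close>.\<close>

lemma skew_energy_dominant:
  assumes lin: "linear A" and skew: "\<And>x y. G (A x) y = - G x (A y)" and tau: "G tau tau < 0"
    and fu: "future_causal g tau u" and fv: "future_causal g tau v"
  shows "G (A u) (A v) + op_trace (\<lambda>x. A (A x)) / 4 * G u v \<ge> 0"
proof -
  let ?\<phi> = "\<lambda>u. G (A u) (A v) + op_trace (\<lambda>x. A (A x)) / 4 * G u v"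
  have vv: "G v v \<le> 0" using fv by (simp add: future_causal_def)
  have timelike: "?\<phi> w \<ge> 0" if w: "future_causal g tau w" "G w w < 0" for w
  proof -
    define m where "m = sqrt (- G w w)"
    have m: "m > 0" "m * m = - G w w" using w by (auto simp: m_def)
    let ?w = "(1 / m) *\<^sub>R w"
    have "G ?w ?w = - 1" using m w by (simp add: field_simps)
    moreover have "G ?w v < 0" using future_product_neg[OF tau w fv] m G_commute[of v w] by (simp add: divide_neg_pos)
    ultimately have "?\<phi> ?w \<ge> 0" using skew_energy_unit[OF lin skew] vv by blast
    moreover have "?\<phi> ?w = ?\<phi> w / m" by (simp add: linear_scale[OF lin] add_divide_distrib)
    ultimately show ?thesis using m by (simp add: zero_le_divide_iff)
  qed
  have ut: "G u tau < 0" "G u u \<le> 0" using fu by (auto simp: future_causal_def)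
  have eps: "?\<phi> u + \<epsilon> * ?\<phi> tau \<ge> 0" if e: "\<epsilon> > 0" for \<epsilon>
  proof -
    let ?w = "u + \<epsilon> *\<^sub>R tau"
    have t: "G ?w tau < 0" using ut tau e by (simp add: add_neg_neg mult_pos_neg)
    have "G ?w ?w = G u u + 2 * (\<epsilon> * G u tau) + \<epsilon>\<^sup>2 * G tau tau"
      by (simp add: G_commute[of tau u] power2_eq_square algebra_simps)
    moreover have "\<epsilon> * G u tau < 0" "\<epsilon>\<^sup>2 * G tau tau < 0" using e ut tau by (auto simp: mult_pos_neg)
    ultimately have w: "G ?w ?w < 0" using ut by linarith
    have "?w \<noteq> 0" using t by (metis G_simps(9) less_irrefl)
    then have "future_causal g tau ?w" using t w unfolding future_causal_def by (blast intro: less_imp_le)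
    from timelike[OF this w] show ?thesis
      by (simp add: linear_add[OF lin] linear_scale[OF lin] algebra_simps)
  qed
  have limit: False if "a < 0" "b \<ge> 0" "\<And>\<epsilon>. \<epsilon> > 0 \<Longrightarrow> a + \<epsilon> * b \<ge> 0" for a b :: real
  proof -
    \<comment> \<open>With this choice \<open>a + \<epsilon> * b\<close> stays below
      \<open>a / 2\<close>; the 1 added to \<open>b\<close> keeps the denominator positive.\<close>
    define \<epsilon> where "\<epsilon> = (- a / 2) / (b + 1)"
    have "\<epsilon> > 0" "\<epsilon> * (b + 1) = - a / 2"
      using that unfolding \<epsilon>_def by (intro divide_pos_pos nonzero_eq_divide_eq[THEN iffD1]; simp)+
    then have "\<epsilon> > 0" "\<epsilon> * b + \<epsilon> = - a / 2" by (auto simp: distrib_left)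
    then show False using that(1) that(3)[of \<epsilon>] by linarith
  qed
  show ?thesis
  proof (rule ccontr)
    assume n: "\<not> ?thesis"
    have "future_causal g tau tau" using tau by (auto simp: future_causal_def)
    then have "?\<phi> tau \<ge> 0" using timelike tau by blast
    then show False using limit[OF _ _ eps] n by (meson not_le)
  qed
qed

section \<open>Traces and the cubic equation of a superenergy tensor\<close>

lemma superenergy_traces:
  assumes F: "two_form F"
  defines "s \<equiv> op_trace (\<lambda>x. mixed F (mixed F x)) / 4"
  shows "trace (superenergy g F) = (real CARD('n) - 4) * s"
    "trace (superenergy g F ** superenergy g F)
      = op_trace (\<lambda>x. mixed F (mixed F (mixed F (mixed F x)))) - 8 * s\<^sup>2 + real CARD('n) * s\<^sup>2"
proof -
  define A where "A = mixed F"
  have lin: "linear A" unfolding A_def by (rule linear_mixed)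
  have T: "superenergy g F *v x = s *\<^sub>R x - A (A x)" for x
    using superenergy_apply[OF F] by (simp add: s_def A_def)
  have s: "op_trace (\<lambda>x. A (A x)) = 4 * s" by (simp add: s_def A_def)
  have "trace (superenergy g F) = op_trace (\<lambda>x. s *\<^sub>R x - A (A x))"
    unfolding op_trace_matrix[symmetric] T ..
  then show "trace (superenergy g F) = (real CARD('n) - 4) * s"
    by (simp add: op_trace_simps s algebra_simps)
  have TT: "(superenergy g F ** superenergy g F) *v x
      = (s * s) *\<^sub>R x - (2 * s) *\<^sub>R A (A x) + A (A (A (A x)))" for x
    by (simp only: T linear_diff[OF lin] linear_scale[OF lin] matrix_vector_mul_assoc[symmetric])
      (simp add: vec_eq_iff algebra_simps)
  have "trace (superenergy g F ** superenergy g F)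
      = op_trace (\<lambda>x. (s * s) *\<^sub>R x - (2 * s) *\<^sub>R A (A x) + A (A (A (A x))))"
    unfolding op_trace_matrix[symmetric] TT ..
  then show "trace (superenergy g F ** superenergy g F)
      = op_trace (\<lambda>x. mixed F (mixed F (mixed F (mixed F x)))) - 8 * s\<^sup>2 + real CARD('n) * s\<^sup>2"
    by (simp only: op_trace_simps s) (simp add: A_def power2_eq_square algebra_simps)
qed

text \<open>Applying \<open>A\<close> once more to the quintic gives a cubic in
  \<open>A^2 = s - T\<close>. Here \<open>\<alpha> = 2 s\<close>, so
  \<open>A^4 - \<alpha> A^2 + \<beta>\<close> has no linear term in \<open>T\<close> and becomes
  \<open>T^2 - q\<close>.\<close>

lemma superenergy_cubic:
  assumes F: "two_form F" "form_rank F \<le> 4"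
  defines "s \<equiv> op_trace (\<lambda>x. mixed F (mixed F x)) / 4"
  defines "q \<equiv> (trace (superenergy g F ** superenergy g F) - (real CARD('n) - 4) * s\<^sup>2) / 4"
  defines "T \<equiv> (\<lambda>x. superenergy g F *v x)"
  shows "T (T (T x)) = s *\<^sub>R T (T x) + q *\<^sub>R T x - (q * s) *\<^sub>R x"
proof -
  define A where "A = mixed F"
  have lin: "linear A" unfolding A_def by (rule linear_mixed)
  note lA = linear_add[OF lin] linear_diff[OF lin] linear_scale[OF lin]
  have T: "T x = s *\<^sub>R x - A (A x)" for x
    using superenergy_apply[OF F(1)] by (simp add: s_def A_def T_def)
  obtain a b c d where abcd: "F = wedge g a b + wedge g c d"
    using two_form_rank_four_wedges[OF F] by metis
  have A: "A x = G b x *\<^sub>R ((1 / 2) *\<^sub>R a) - G ((1 / 2) *\<^sub>R a) x *\<^sub>R b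
      + G d x *\<^sub>R ((1 / 2) *\<^sub>R c) - G ((1 / 2) *\<^sub>R c) x *\<^sub>R d" for x
    by (simp add: A_def abcd mixed_add mixed_wedge)
  define t where "t = op_trace (\<lambda>x. A (A (A (A x))))"
  have s2: "op_trace (\<lambda>x. A (A x)) / 2 = 2 * s" by (simp add: s_def A_def)
  have q: "q = (t - 4 * s\<^sup>2) / 4"
    unfolding q_def superenergy_traces(2)[OF F(1), folded s_def] by (simp add: t_def A_def algebra_simps)
  have quintic: "A (A (A (A (A x)))) = (2 * s) *\<^sub>R A (A (A x)) - ((8 * s\<^sup>2 - t) / 4) *\<^sub>R A x" for x
    using rank_four_quintic[of A, OF A, of x] unfolding s2 by (simp add: t_def power_mult_distrib)
  then have "A (A (A (A (A (A x))))) = A ((2 * s) *\<^sub>R A (A (A x)) - ((8 * s\<^sup>2 - t) / 4) *\<^sub>R A x)"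
    by metis
  then have sextic: "A (A (A (A (A (A x)))))
      = (2 * s) *\<^sub>R A (A (A (A x))) - ((8 * s\<^sup>2 - t) / 4) *\<^sub>R A (A x)"
    by (simp only: lA)
  show ?thesis
    unfolding T lA sextic q
    by (simp add: vec_eq_iff) (simp add: field_simps power2_eq_square)
qed

end

section \<open>Operators satisfying the dominant energy condition and the cubic equation\<close>

context lorentz_space
begin

definition two_orthogonal_wedges :: "(real^'n \<Rightarrow> real^'n) \<Rightarrow> bool" where
  "two_orthogonal_wedges B \<longleftrightarrow> (\<exists>u v u' v'. G u v = 0 \<and> G u' v' = 0 \<and> G u u' = 0 \<and> G u v' = 0
     \<and> G v u' = 0 \<and> G v v' = 0 \<and> (\<forall>x. B x = (G v v * G u x) *\<^sub>R u + (G u u * G v x) *\<^sub>R v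
       + (G v' v' * G u' x) *\<^sub>R u' + (G u' u' * G v' x) *\<^sub>R v'))"

text \<open>Nonnegative weights are absorbed as square roots into \<open>a\<close> and
  \<open>c\<close>.\<close>

lemma two_orthogonal_wedgesI:
  assumes o: "G a b = 0" "G c d = 0" "G a c = 0" "G a d = 0" "G b c = 0" "G b d = 0"
    and ml: "m \<ge> 0" "l \<ge> 0"
    and B: "\<And>x. B x = m *\<^sub>R ((G b b * G a x) *\<^sub>R a + (G a a * G b x) *\<^sub>R b)
      + l *\<^sub>R ((G d d * G c x) *\<^sub>R c + (G c c * G d x) *\<^sub>R d)"
  shows "two_orthogonal_wedges B"
proof -
  have sq: "sqrt m * sqrt m = m" "sqrt l * sqrt l = l" using ml by auto
  have e: "y * (w * z) * w = k * (y * z)" "w * (w * y) * z = k * (y * z)" if "w * w = k" for w k y z :: real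
    using that by (simp_all add: mult_ac flip: that)
  show ?thesis unfolding two_orthogonal_wedges_def
  proof (intro exI conjI allI)
    show "B x = (G b b * G (sqrt m *\<^sub>R a) x) *\<^sub>R (sqrt m *\<^sub>R a)
      + (G (sqrt m *\<^sub>R a) (sqrt m *\<^sub>R a) * G b x) *\<^sub>R b
      + (G d d * G (sqrt l *\<^sub>R c) x) *\<^sub>R (sqrt l *\<^sub>R c)
      + (G (sqrt l *\<^sub>R c) (sqrt l *\<^sub>R c) * G d x) *\<^sub>R d" for x
      unfolding B G_simps scaleR_scaleR e[OF sq(1)] e[OF sq(2)] scaleR_add_right by (simp only: add.assoc)
  qed (simp_all add: o)
qed

lemma eigenvectors_orthogonal:
  assumes "symmetric_op T" "T x = a *\<^sub>R x" "T y = b *\<^sub>R y" "a \<noteq> b"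
  shows "G x y = 0"
  using symmetric_opD(2)[OF assms(1), of x y] assms by simp

text \<open>At most one vector of an orthonormal basis is timelike, so at least two of three are
  spacelike.\<close>

lemma projection_spacelike_pair:
  assumes Q: "projection Q" and tr: "op_trace Q \<ge> 3"
  obtains a b where "Q a = a" "Q b = b" "G a a = 1" "G b b = 1" "G a b = 0"
proof -
  obtain S where S: "orthonormal S" "op_trace Q = real (card S)" "\<And>e. e \<in> S \<Longrightarrow> Q e = e"
    by (rule projection_orthonormal_basis[OF Q]) blast
  let ?N = "{e \<in> S. G e e = -1}"
  have fin: "finite S" using S by (simp add: orthonormal_def)
  have "card ?N \<le> 1"
  proof (rule card_le_Suc0_iff_eq[THEN iffD2, unfolded One_nat_def[symmetric]])
    show "finite ?N" using fin by simp
    show "\<forall>e\<in>?N. \<forall>f\<in>?N. e = f"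
    proof (intro ballI, rule ccontr)
      fix e f assume ef: "e \<in> ?N" "f \<in> ?N" "e \<noteq> f"
      then have "G e f = 0" using S by (auto simp: orthonormal_def)
      moreover have "f \<noteq> 0" using ef by auto
      ultimately show False using reverse[of e f] ef by auto
    qed
  qed
  moreover have "card (S - ?N) = card S - card ?N" by (rule card_Diff_subset) (use fin in auto)
  ultimately have "card (S - ?N) \<ge> 2" using tr S by linarith
  then obtain R where R: "R \<subseteq> S - ?N" "card R = 2" by (meson obtain_subset_with_card_n)
  then obtain a b where "R = {a, b}" "a \<noteq> b" by (meson card_2_iff)
  then have ab: "a \<noteq> b" "{a, b} \<subseteq> S - ?N" using R by auto
  then have "G a a = 1" "G b b = 1" "G a b = 0" using S by (auto simp: orthonormal_def)
  then show thesis using that[of a b] ab S by auto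
qed

text \<open>The nilpotent part is \<open>c k \<otimes> k\<close> with \<open>k\<close> null. It is
  minus the square of a null simple form, a multiple of the wedge of \<open>k\<close> and
  \<open>e\<close>, for any unit spacelike \<open>e\<close> orthogonal to \<open>k\<close>. Such an
  \<open>e\<close> is found in a spacelike plane in the range of \<open>Q\<close>, which is
  orthogonal to \<open>u\<close> and \<open>v\<close>.\<close>

lemma two_orthogonal_wedges_null:
  assumes uv: "G u v = 0" "m \<ge> 0" and Q: "projection Q" "op_trace Q \<ge> 3" "Q u = 0" "Q v = 0"
    and N: "symmetric_op N" "\<And>x. N (N x) = 0" "\<And>x. Q (N x) = N x"
    and c: "\<And>k c. \<lbrakk>k \<noteq> 0; G k k = 0; Q k = k; \<And>x. N x = (c * G k x) *\<^sub>R k\<rbrakk> \<Longrightarrow> c \<ge> 0"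
    and B: "\<And>x. B x = m *\<^sub>R ((G v v * G u x) *\<^sub>R u + (G u u * G v x) *\<^sub>R v) + N x"
  shows "two_orthogonal_wedges B"
proof (cases "\<forall>x. N x = 0")
  case True
  then show ?thesis
    by (intro two_orthogonal_wedgesI[of u v 0 0 m 0]) (simp_all add: uv B)
next
  case False
  then obtain w where "N w \<noteq> 0" by blast
  then obtain k c where k: "k = N w" "G k k = 0" "k \<noteq> 0" and Nk: "\<And>x. N x = (c * G k x) *\<^sub>R k"
    using square_zero_symmetric[OF N(1,2)] by blast
  have Qk: "Q k = k" using N(3) k by simp
  have c0: "c \<ge> 0" using c[OF k(3,2) Qk Nk] .
  obtain a b where ab: "Q a = a" "Q b = b" "G a a = 1" "G b b = 1" "G a b = 0"
    using projection_spacelike_pair[OF Q(1,2)] by blast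
  obtain p q where pq: "G (p *\<^sub>R a + q *\<^sub>R b) (p *\<^sub>R a + q *\<^sub>R b) = 1" "G k (p *\<^sub>R a + q *\<^sub>R b) = 0"
    using unit_orthogonal_in_plane[OF ab(3-5)] by blast
  define e where "e = p *\<^sub>R a + q *\<^sub>R b"
  have e: "G e e = 1" "G k e = 0" using pq by (auto simp: e_def)
  have Qe: "Q e = e"
    using projectionD(2)[OF Q(1)] ab by (simp add: e_def linear_add linear_scale)
  have perp: "G x y = 0" if "Q x = 0" "Q y = y" for x y
    using projectionD(4)[OF Q(1), of x y] that by simp
  show ?thesis
    by (rule two_orthogonal_wedgesI[of u v k e m c])
      (simp_all add: uv B e k(2) perp Q(3,4) Qk Qe c0 Nk)
qed

end

locale dominant_cubic = dominant_operator g tau T for g :: "real^'n^'n" and tau T +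
  fixes s q :: real
  assumes card_gt: "CARD('n) > 4"
    and trT: "op_trace T = (real CARD('n) - 4) * s"
    and trTT: "op_trace (\<lambda>x. T (T x)) = 4 * q + (real CARD('n) - 4) * s\<^sup>2"
    and cubic: "T (T (T x)) = s *\<^sub>R T (T x) + q *\<^sub>R T x - (q * s) *\<^sub>R x"
begin

section \<open>Eigenprojections and their multiplicities\<close>

text \<open>The cofactor of the root \<open>s\<close> is \<open>X^2 - q\<close>, with value
  \<open>s^2 - q\<close> at \<open>s\<close>; the trace identities give
  \<open>(n - 4) (s^2 - q)\<close> as trace of the cofactor.\<close>

lemma projection_s:
  assumes "q \<noteq> s\<^sup>2"
  obtains P where "projection P" "\<And>x. T (P x) = s *\<^sub>R P x" "\<And>x. P (T x) = s *\<^sub>R P x"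
    "op_trace P = real CARD('n) - 4" "\<And>x. (s\<^sup>2 - q) *\<^sub>R P x = T (T x) - q *\<^sub>R x"
proof -
  define d where "d = s\<^sup>2 - q"
  define P where "P x = (1 / d) *\<^sub>R (T (T x) + 0 *\<^sub>R T x + (- q) *\<^sub>R x)" for x
  have d: "d = s\<^sup>2 + 0 * s + (- q)" "d \<noteq> 0" using assms by (auto simp: d_def)
  have c: "T (T (T x)) + 0 *\<^sub>R T (T x) + (- q) *\<^sub>R T x
      = s *\<^sub>R (T (T x) + 0 *\<^sub>R T x + (- q) *\<^sub>R x)" for x
    by (simp add: cubic algebra_simps)
  note P = spectral_projection[OF symT d c P_def]
  have "op_trace P = ((real CARD('n) - 4) * d) / d"
    unfolding P(4) trT trTT d_def by (simp add: algebra_simps)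
  then have "op_trace P = real CARD('n) - 4" using d(2) by simp
  moreover have "(s\<^sup>2 - q) *\<^sub>R P x = T (T x) - q *\<^sub>R x" for x
    using d(2) by (simp add: P_def flip: d_def)
  ultimately show thesis using that P(1,2,3) by blast
qed

text \<open>The cofactor of the root \<open>r\<close> is \<open>(X + r) (X - s)\<close>, with value
  \<open>2 r (r - s)\<close> at \<open>r\<close>; the trace identities give twice this
  value.\<close>

lemma projection_root:
  assumes r: "r\<^sup>2 = q" "r \<noteq> 0" "r \<noteq> s"
  obtains P where "projection P" "\<And>x. T (P x) = r *\<^sub>R P x" "\<And>x. P (T x) = r *\<^sub>R P x"
    "op_trace P = 2" "\<And>x. (2 * r * (r - s)) *\<^sub>R P x = T (T x) + (r - s) *\<^sub>R T x - (r * s) *\<^sub>R x"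
proof -
  define d where "d = 2 * r * (r - s)"
  define P where "P x = (1 / d) *\<^sub>R (T (T x) + (r - s) *\<^sub>R T x + (- (r * s)) *\<^sub>R x)" for x
  have d: "d = r\<^sup>2 + (r - s) * r + (- (r * s))" "d \<noteq> 0"
    using r by (auto simp: d_def power2_eq_square algebra_simps)
  have c: "T (T (T x)) + (r - s) *\<^sub>R T (T x) + (- (r * s)) *\<^sub>R T x
      = r *\<^sub>R (T (T x) + (r - s) *\<^sub>R T x + (- (r * s)) *\<^sub>R x)" for x
    by (simp add: cubic r(1)[symmetric] power2_eq_square algebra_simps)
  note P = spectral_projection[OF symT d c P_def]
  have "op_trace P = (2 * d) / d"
    unfolding P(4) trT trTT d_def r(1)[symmetric] by (simp add: power2_eq_square algebra_simps)
  then have "op_trace P = 2" using d(2) by simp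
  moreover have "(2 * r * (r - s)) *\<^sub>R P x = T (T x) + (r - s) *\<^sub>R T x - (r * s) *\<^sub>R x" for x
    using d(2) by (simp add: P_def flip: d_def)
  ultimately show thesis using that P(1,2,3) by blast
qed

text \<open>As \<open>T - s\<close> vanishes on the eigenspace of \<open>s\<close>, only the
  eigenprojections of \<open>r\<close> and \<open>- r\<close> enter it. The identity is verified
  after multiplication by \<open>2 r\<close>.\<close>

lemma projection_roots:
  assumes r: "r\<^sup>2 = q" "r > 0" "q \<noteq> s\<^sup>2"
  obtains P P' where "projection P" "\<And>x. T (P x) = r *\<^sub>R P x" "op_trace P = 2"
    "projection P'" "\<And>x. T (P' x) = (- r) *\<^sub>R P' x" "op_trace P' = 2"
    "\<And>x. T x - s *\<^sub>R x = (r - s) *\<^sub>R P x - (r + s) *\<^sub>R P' x"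
proof -
  have n: "r \<noteq> s" "- r \<noteq> s" using r by auto
  obtain P where P: "projection P" "\<And>x. T (P x) = r *\<^sub>R P x" "op_trace P = 2"
    "\<And>x. (2 * r * (r - s)) *\<^sub>R P x = T (T x) + (r - s) *\<^sub>R T x - (r * s) *\<^sub>R x"
    by (rule projection_root[of r]) (use r n in auto)
  obtain P' where P': "projection P'" "\<And>x. T (P' x) = (- r) *\<^sub>R P' x" "op_trace P' = 2"
    "\<And>x. (2 * (- r) * (- r - s)) *\<^sub>R P' x = T (T x) + (- r - s) *\<^sub>R T x - (- r * s) *\<^sub>R x"
    by (rule projection_root[of "- r"]) (use r n in auto)
  have "T x - s *\<^sub>R x = (r - s) *\<^sub>R P x - (r + s) *\<^sub>R P' x" for x
  proof -
    have "(2 * r) *\<^sub>R ((r - s) *\<^sub>R P x - (r + s) *\<^sub>R P' x)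
        = (2 * r * (r - s)) *\<^sub>R P x - (2 * (- r) * (- r - s)) *\<^sub>R P' x"
      by (simp add: algebra_simps)
    also have "\<dots> = (2 * r) *\<^sub>R (T x - s *\<^sub>R x)"
      unfolding P(4) P'(4) by (simp add: vec_eq_iff algebra_simps)
    finally show ?thesis using r(2) by simp
  qed
  then show thesis using that P(1-3) P'(1-3) by blast
qed

section \<open>The case \<open>q < s^2\<close>\<close>

text \<open>If the timelike direction were complementary to the \<open>s\<close>-eigenspace, that complement would
  contain a causal eigenvector \<open>k\<close> with eigenvalue \<open>- sqrt q\<close>. Boosting a timelike vector
  towards \<open>k\<close> makes the energy density relative to its norm approach \<open>sqrt q\<close>, and this violates
  the dominant energy condition against an eigenvector for \<open>s\<close>.\<close>

lemma timelike_eigenvector_s: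
  assumes less: "q < s\<^sup>2" and P: "projection P" "\<And>x. T (P x) = s *\<^sub>R P x"
    "\<And>x. P (T x) = s *\<^sub>R P x" "op_trace P = real CARD('n) - 4"
    "\<And>x. (s\<^sup>2 - q) *\<^sub>R P x = T (T x) - q *\<^sub>R x"
  obtains t where "G (P t) (P t) < 0"
proof -
  have "op_trace P \<noteq> 0" using card_gt P(4) by simp
  then obtain x' where "P x' \<noteq> 0"
    using op_trace_zero by (metis ext)
  then obtain x0 where x0: "x0 \<noteq> 0" "T x0 = s *\<^sub>R x0" "P x0 = x0"
    using P(2) projectionD(3)[OF P(1)] by metis
  have False if t: "G (t - P t) (t - P t) < 0" for t
  proof -
    obtain e where e: "future e" "G e e < 0" "P e = 0"
    proof -
      have "t - P t \<noteq> 0" using t by (metis G_simps(9) less_irrefl)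
      then consider "future (t - P t)" | "future (- (t - P t))"
        using future_or_past t by (meson less_imp_le)
      moreover have "P (t - P t) = 0" "P (- (t - P t)) = 0"
        using projectionD(2,3)[OF P(1)] by (simp_all add: linear_diff linear_neg)
      moreover have "G (- (t - P t)) (- (t - P t)) < 0" using t by simp
      ultimately show thesis using that t by blast
    qed
    have TTe: "T (T e) = q *\<^sub>R e" using P(5)[of e] e(3) by simp
    have ex: "G e x0 = 0" using projectionD(4)[OF P(1), of e x0] e(3) x0(3) by simp
    \<comment> \<open>\<open>T e\<close> is again causal while \<open>e\<close> is timelike;
      comparing norms gives \<open>q \<ge> 0\<close>.\<close>
    have "G (T e) (T e) = q * G e e" using T_sym[of e "T e"] TTe by simp
    then have "q * G e e \<le> 0" using causal_image[OF e(1)] by simp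
    then have q0: "q \<ge> 0" using e(2) by (simp add: mult_le_0_iff)
    define r where "r = sqrt q"
    have r: "r \<ge> 0" "r * r = q" using q0 by (auto simp: r_def)
    have rs: "r < \<bar>s\<bar>" using less r_def real_sqrt_less_mono[OF less] by simp
    define \<rho> where "\<rho> = G e (T e)"
    have \<rho>: "\<rho> \<ge> 0" using dec e(1) by (simp add: \<rho>_def)
    define k where "k = r *\<^sub>R e - T e"
    have Tk: "T k = (- r) *\<^sub>R k" using r(2) by (simp add: k_def TTe algebra_simps)
    have kx: "G k x0 = 0" using T_sym[of e x0] ex x0(2) by (simp add: k_def)
    have ke: "G k e = r * G e e - \<rho>" by (simp add: k_def \<rho>_def T_sym)
    have "G k k = 2 * r * (r * G e e - \<rho>)"
      using T_sym[of e "T e"] r(2)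
      by (simp add: k_def \<rho>_def TTe T_sym algebra_simps)
    moreover have ke_le: "r * G e e - \<rho> \<le> 0"
      using r(1) e(2) \<rho> mult_nonneg_nonpos[of r "G e e"] by linarith
    ultimately have kk: "G k k \<le> 0" using r(1) by (simp add: mult_nonneg_nonpos)
    have "k \<noteq> 0"
    proof
      assume "k = 0"
      then have Te: "T e = r *\<^sub>R e" by (simp add: k_def)
      then have "r = 0" using timelike_eigenvalue_nonpos[OF e(2) Te] r(1) by simp
      then show False
        using timelike_eigenvalue_dominates[OF e(2) Te ex x0(1,2)] rs by simp
    qed
    then have \<kappa>: "G k e < 0"
      using causal_not_orthogonal[OF e(2) kk] ke ke_le by force
    \<comment> \<open>The boost is chosen so large that \<open>X * (\<bar>s\<bar> - r)\<close>
      exceeds \<open>\<rho>\<close>, whereas \<open>eigenvalue_bound\<close> for \<open>u\<close>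
      and \<open>x0\<close> would give at most \<open>\<rho>\<close>.\<close>
    define t where "t = (\<rho> + 1) / (- 2 * G k e * (\<bar>s\<bar> - r))"
    define X where "X = - (t * t * G k k) - 2 * t * G k e"
    have den: "- 2 * G k e * (\<bar>s\<bar> - r) > 0" using \<kappa> rs by (simp add: mult_neg_pos)
    have t: "t > 0" unfolding t_def using den \<rho> by (intro divide_pos_pos) auto
    have X: "X \<ge> - 2 * t * G k e" using kk by (simp add: X_def mult_nonneg_nonpos)
    then have "X * (\<bar>s\<bar> - r) \<ge> - 2 * t * G k e * (\<bar>s\<bar> - r)" using rs by (intro mult_right_mono) auto
    also have "- 2 * t * G k e * (\<bar>s\<bar> - r) = t * (- 2 * G k e * (\<bar>s\<bar> - r))" by simp
    also have "\<dots> = \<rho> + 1" unfolding t_def using den by (intro nonzero_eq_divide_eq[THEN iffD1]) auto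
    finally have big: "X * (\<bar>s\<bar> - r) \<ge> \<rho> + 1" .
    define u where "u = t *\<^sub>R k + e"
    have uu: "G u u = - X + G e e" by (simp add: u_def X_def G_commute[of e k] algebra_simps)
    have "X \<ge> 0" using X t \<kappa> mult_pos_neg[OF t \<kappa>] by linarith
    then have "G u u < 0" using uu e(2) by linarith
    moreover have "G u x0 = 0" using kx ex by (simp add: u_def)
    ultimately have "\<bar>s\<bar> * (- G u u) \<le> G u (T u)" using eigenvalue_bound x0 by blast
    moreover have "G u (T u) = r * X + \<rho>"
    proof -
      have "G k (T e) = - r * G k e" using T_sym[of k e] by (simp add: Tk)
      then show ?thesis by (simp add: u_def X_def \<rho>_def Tk G_commute[of e k] algebra_simps)
    qed
    ultimately have "\<bar>s\<bar> * X - \<bar>s\<bar> * G e e \<le> r * X + \<rho>" by (simp add: uu algebra_simps)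
    moreover have "\<bar>s\<bar> * G e e \<le> 0" using e(2) by (simp add: mult_nonneg_nonpos)
    ultimately show False using big by (simp add: algebra_simps)
  qed
  then show thesis using projection_timelike_cases[OF P(1)] that by blast
qed

text \<open>A timelike vector in the eigenspace of \<open>s\<close> gives \<open>s \<le> 0\<close>
  and makes the complement Euclidean. On the complement \<open>T^2 = q\<close>, so
  \<open>q \<ge> 0\<close> unless the complement is zero, which the trace \<open>n - 4\<close>
  excludes.\<close>

lemma spacelike_case:
  assumes less: "q < s\<^sup>2"
  obtains P t where "projection P" "\<And>x. T (P x) = s *\<^sub>R P x"
    "\<And>x. P (T x) = s *\<^sub>R P x" "op_trace P = real CARD('n) - 4"
    "\<And>x. (s\<^sup>2 - q) *\<^sub>R P x = T (T x) - q *\<^sub>R x"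
    "G (P t) (P t) < 0" "0 \<le> q" "sqrt q < - s"
proof -
  have "q \<noteq> s\<^sup>2" using less by simp
  then obtain P where P: "projection P" "\<And>x. T (P x) = s *\<^sub>R P x"
    "\<And>x. P (T x) = s *\<^sub>R P x" "op_trace P = real CARD('n) - 4"
    "\<And>x. (s\<^sup>2 - q) *\<^sub>R P x = T (T x) - q *\<^sub>R x"
    by (rule projection_s) blast
  obtain t where t: "G (P t) (P t) < 0" using timelike_eigenvector_s[OF less P] by blast
  have s0: "s \<le> 0" using timelike_eigenvalue_nonpos[OF t P(2)] .
  have q0: "q \<ge> 0"
  proof (rule ccontr)
    assume q: "\<not> q \<ge> 0"
    have "x = P x" for x
    proof (rule ccontr)
      assume x: "x \<noteq> P x"
      let ?y = "x - P x"
      have y: "G ?y ?y > 0" using projection_complement_positive[OF P(1) t x] .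
      have "P ?y = 0" using projectionD(2,3)[OF P(1)] by (simp add: linear_diff)
      then have TT: "T (T ?y) = q *\<^sub>R ?y" using P(5)[of ?y] by (metis eq_iff_diff_eq_0 scaleR_zero_right)
      have "G (T ?y) (T ?y) = q * G ?y ?y" using T_sym[of ?y "T ?y"] unfolding TT G_simps(8) .
      then have neg: "G (T ?y) (T ?y) < 0" using q y by (simp only: mult_neg_pos not_le)
      have "G (P t) (T ?y) = s * G (P t) ?y" using T_sym[of "P t" ?y] unfolding P(2) by (simp only: G_simps(7))
      then have "G (P t) (T ?y) = 0" using projection_orthogonal[OF P(1)] by simp
      then show False using orthogonal_timelike_nonneg[OF t] neg by (meson not_le)
    qed
    then have "op_trace P = real CARD('n)" using op_trace_ident by (metis ext)
    then show False using P(4) by simp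
  qed
  have "sqrt q < \<bar>s\<bar>" using real_sqrt_less_mono[OF less] by simp
  then have "sqrt q < - s" using s0 by simp
  then show thesis using that P t q0 by blast
qed

text \<open>For \<open>r > 0\<close> the weights \<open>r - s\<close> and \<open>- (r + s)\<close>
  are positive and both eigenplanes are Euclidean, being orthogonal to the timelike
  direction.\<close>

lemma two_wedges_spacelike:
  assumes less: "q < s\<^sup>2"
  shows "two_orthogonal_wedges (\<lambda>x. T x - s *\<^sub>R x)"
proof -
  obtain P t where P: "projection P" "\<And>x. T (P x) = s *\<^sub>R P x"
    "\<And>x. P (T x) = s *\<^sub>R P x" "op_trace P = real CARD('n) - 4"
    "\<And>x. (s\<^sup>2 - q) *\<^sub>R P x = T (T x) - q *\<^sub>R x"
    and t: "G (P t) (P t) < 0" and q: "0 \<le> q" "sqrt q < - s"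
    by (rule spacelike_case[OF less]) blast
  define r where "r = sqrt q"
  have r: "r \<ge> 0" "r\<^sup>2 = q" "r < - s" using q by (auto simp: r_def)
  show ?thesis
  proof (cases "r = 0")
    case False
    then have r0: "r > 0" "q \<noteq> s\<^sup>2" using r less by auto
    obtain P1 P2 where P1: "projection P1" "\<And>x. T (P1 x) = r *\<^sub>R P1 x" "op_trace P1 = 2"
      and P2: "projection P2" "\<And>x. T (P2 x) = (- r) *\<^sub>R P2 x" "op_trace P2 = 2"
      and dec: "\<And>x. T x - s *\<^sub>R x = (r - s) *\<^sub>R P1 x - (r + s) *\<^sub>R P2 x"
      by (rule projection_roots[OF r(2) r0]) blast
    have "G (P t) (P1 x) = 0" "G (P t) (P2 x) = 0" for x
      using eigenvectors_orthogonal[OF symT P(2) P1(2), of t x]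
        eigenvectors_orthogonal[OF symT P(2) P2(2), of t x] r(3) r0(1) by auto
    then have pos: "P1 x \<noteq> 0 \<Longrightarrow> G (P1 x) (P1 x) > 0" "P2 x \<noteq> 0 \<Longrightarrow> G (P2 x) (P2 x) > 0" for x
      using reverse[OF t] by blast+
    obtain a b where ab: "G a b = 0" "P1 a = a" "P1 b = b" "G a a = 1" "G b b = 1"
      "\<And>x. P1 x = G a x *\<^sub>R a + G b x *\<^sub>R b"
      by (rule projection_rank_two_spacelike[OF P1(1,3) pos(1)]) blast+
    obtain c d where cd: "G c d = 0" "P2 c = c" "P2 d = d" "G c c = 1" "G d d = 1"
      "\<And>x. P2 x = G c x *\<^sub>R c + G d x *\<^sub>R d"
      by (rule projection_rank_two_spacelike[OF P2(1,3) pos(2)]) blast+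
    have cross: "G x y = 0" if "P1 x = x" "P2 y = y" for x y
      using eigenvectors_orthogonal[OF symT P1(2) P2(2), of x y] that False by simp
    show ?thesis
    proof (rule two_orthogonal_wedgesI)
      show "T x - s *\<^sub>R x = (r - s) *\<^sub>R ((G b b * G a x) *\<^sub>R a + (G a a * G b x) *\<^sub>R b)
        + (- (r + s)) *\<^sub>R ((G d d * G c x) *\<^sub>R c + (G c c * G d x) *\<^sub>R d)" for x
        unfolding dec ab(6) cd(6) by (simp add: ab(4,5) cd(4,5) algebra_simps)
    qed (use r in \<open>simp_all add: ab(1) cd(1) cross[OF ab(2) cd(2)] cross[OF ab(2) cd(3)]
        cross[OF ab(3) cd(2)] cross[OF ab(3) cd(3)]\<close>)
  next
    case True
    \<comment> \<open>The two eigenplanes merge. On the Euclidean complement of the eigenspace of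
      \<open>s\<close> the symmetric operator \<open>T\<close> has square zero, hence vanishes, and
      any orthonormal basis of these four dimensions can be split into two planes.\<close>
    then have q0: "q = 0" using r by simp
    let ?Q = "\<lambda>x. x - P x"
    have Q: "projection ?Q" using projection_complement[OF P(1)] .
    have TQ: "T (?Q x) = 0" for x
    proof (rule ccontr)
      let ?y = "T (?Q x)"
      assume nz: "?y \<noteq> 0"
      have Py: "P (?Q x) = 0" "P ?y = 0" using P(3) projectionD(2,3)[OF P(1)] by (simp_all add: linear_diff)
      have "T ?y = 0" using P(5)[of "?Q x"] unfolding Py q0 by simp
      then have "G ?y ?y = 0" using T_sym[of "?Q x" ?y] by (simp only: G_simps)
      moreover have "?y - P ?y = ?y" using Py by simp
      ultimately show False
        using projection_complement_positive[OF P(1) t, of ?y] nz Py by auto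
    qed
    have Tx: "T x - s *\<^sub>R x = (- s) *\<^sub>R ?Q x" for x
    proof -
      have "T x = T (P x) + T (?Q x)" by simp
      then show ?thesis by (simp only: TQ P(2)) (simp add: algebra_simps)
    qed
    have "op_trace ?Q = 4" using P(4) by (simp add: op_trace_diff op_trace_ident)
    moreover obtain S where S: "orthonormal S" "\<And>x. ?Q x = (\<Sum>e\<in>S. (G e e * G e x) *\<^sub>R e)"
      "op_trace ?Q = real (card S)" "\<And>e. e \<in> S \<Longrightarrow> ?Q e = e"
      by (rule projection_orthonormal_basis[OF Q]) blast
    ultimately have "card S = 4" by simp
    then obtain a b c d where abcd: "S = {a, b, c, d}" "distinct [a, b, c, d]"
    proof -
      obtain a S1 where 1: "S = insert a S1" "a \<notin> S1" "card S1 = 3"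
        using \<open>card S = 4\<close> by (metis card_Suc_eq numeral_3_eq_3 numeral_nat(2) eval_nat_numeral(2) semiring_norm(26,27))
      obtain b c d where "S1 = {b, c, d}" "distinct [b, c, d]"
        using 1(3) by (metis card_3_iff distinct_length_2_or_more distinct_singleton)
      then show thesis using that 1 by auto
    qed
    have pos: "G e e = 1" if "e \<in> S" for e
    proof -
      have e1: "G e e = 1 \<or> G e e = -1" using S(1) that by (simp add: orthonormal_def)
      then have "e \<noteq> 0" by auto
      moreover have Pe: "P e = 0" using S(4)[OF that] by simp
      ultimately have "G e e > 0" using projection_complement_positive[OF P(1) t, of e] by simp
      then show ?thesis using e1 by auto
    qed
    have o: "G e f = 0" if "e \<in> S" "f \<in> S" "e \<noteq> f" for e f using S(1) that by (simp add: orthonormal_def)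
    have Qx: "?Q x = G a x *\<^sub>R a + G b x *\<^sub>R b + G c x *\<^sub>R c + G d x *\<^sub>R d" for x
      using S(2)[of x] abcd pos by simp
    show ?thesis
    proof (rule two_orthogonal_wedgesI)
      show "T x - s *\<^sub>R x = (- s) *\<^sub>R ((G b b * G a x) *\<^sub>R a + (G a a * G b x) *\<^sub>R b)
        + (- s) *\<^sub>R ((G d d * G c x) *\<^sub>R c + (G c c * G d x) *\<^sub>R d)" for x
        unfolding Tx Qx using abcd pos by (simp add: algebra_simps)
    qed (use abcd o r in auto)
  qed
qed

section \<open>The case \<open>q > s^2\<close>\<close>

text \<open>A timelike vector orthogonal to the eigenspace of \<open>- r\<close> has components in
  those of \<open>r\<close> and \<open>s\<close>. The first is not timelike, as
  \<open>r > 0\<close>. If the second were, its eigenvalue would dominate \<open>r\<close>,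
  contradicting \<open>\<bar>s\<bar> < r\<close>. So the eigenplane of \<open>- r\<close> contains
  the timelike direction.\<close>

lemma timelike_case:
  assumes less: "s\<^sup>2 < q"
  defines "r \<equiv> sqrt q"
  obtains a b c d where "\<bar>s\<bar> < r" "G a a = 1" "G b b = 1" "G c c = -1" "G d d = 1"
    "G a b = 0" "G a c = 0" "G a d = 0" "G b c = 0" "G b d = 0" "G c d = 0"
    "\<And>x. T x - s *\<^sub>R x = (r - s) *\<^sub>R (G a x *\<^sub>R a + G b x *\<^sub>R b)
       - (r + s) *\<^sub>R (G d x *\<^sub>R d - G c x *\<^sub>R c)"
proof -
  have "sqrt (s\<^sup>2) < r" unfolding r_def using less by (rule real_sqrt_less_mono)
  then have rs: "\<bar>s\<bar> < r" by simp
  then have r0: "r > 0" "r\<^sup>2 = q" "q \<noteq> s\<^sup>2"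
    using less zero_le_power2[of s] le_less_trans[OF zero_le_power2 less] by (auto simp: r_def)
  obtain P1 P2 where P1: "projection P1" "\<And>x. T (P1 x) = r *\<^sub>R P1 x" "op_trace P1 = 2"
    and P2: "projection P2" "\<And>x. T (P2 x) = (- r) *\<^sub>R P2 x" "op_trace P2 = 2"
    and dec': "\<And>x. T x - s *\<^sub>R x = (r - s) *\<^sub>R P1 x - (r + s) *\<^sub>R P2 x"
    by (rule projection_roots[OF r0(2,1,3)]) blast
  obtain a0 b0 where ab0: "P1 b0 = b0" "G b0 b0 = 1"
    by (rule projection_rank_two[OF P1(1,3)]) blast
  have b0: "b0 \<noteq> 0" "T b0 = r *\<^sub>R b0" using ab0 P1(2)[of b0] by auto
  obtain t where t: "G (P2 t) (P2 t) < 0"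
  proof (rule projection_timelike_cases[OF P2(1)])
    fix t assume t: "G (t - P2 t) (t - P2 t) < 0"
    define w where "w = t - P2 t"
    have "P2 w = 0" using projectionD(2,3)[OF P2(1)] by (simp add: w_def linear_diff)
    then have e1: "T w - s *\<^sub>R w = (r - s) *\<^sub>R P1 w" using dec'[of w] by simp
    define e where "e = w - P1 w"
    have "T e = s *\<^sub>R e"
      using e1 by (simp add: e_def P1(2) algebra_simps)
    moreover have "G (P1 w) (P1 w) \<ge> 0"
      using timelike_eigenvalue_nonpos[of "P1 w" r] P1(2) r0 by (meson not_le)
    moreover have "G w w = G (P1 w) (P1 w) + G e e"
    proof -
      have "G w w = G (P1 w + e) (P1 w + e)" by (simp add: e_def)
      moreover have "G (P1 w) e = 0" unfolding e_def by (rule projection_orthogonal[OF P1(1)])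
      ultimately show ?thesis by (simp add: G_commute)
    qed
    ultimately have e: "T e = s *\<^sub>R e" "G e e < 0" using t by (simp_all add: w_def)
    have "G e b0 = 0" using eigenvectors_orthogonal[OF symT e(1) b0(2)] rs by auto
    then have "\<bar>r\<bar> \<le> - s" using timelike_eigenvalue_dominates[OF e(2,1) _ b0] by blast
    then show thesis using rs by simp
  qed (use that in blast)
  have cross: "G x y = 0" if "P1 x = x" "P2 y = y" for x y
    using eigenvectors_orthogonal[OF symT P1(2) P2(2), of x y] that r0 by simp
  have "G (P2 t) (P1 x) = 0" for x
    using cross[of "P1 x" "P2 t"] projectionD(3)[OF P1(1)] projectionD(3)[OF P2(1)] by (simp add: G_commute)
  then have pos: "P1 x \<noteq> 0 \<Longrightarrow> G (P1 x) (P1 x) > 0" for x using reverse[OF t] by blast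
  obtain a b where ab: "G a b = 0" "P1 a = a" "P1 b = b" "G a a = 1" "G b b = 1"
    "\<And>x. P1 x = G a x *\<^sub>R a + G b x *\<^sub>R b"
    by (rule projection_rank_two_spacelike[OF P1(1,3) pos]) blast+
  obtain c d where cd: "G c d = 0" "P2 c = c" "P2 d = d" "G c c = -1" "G d d = 1"
    "\<And>x. P2 x = (- G c x) *\<^sub>R c + G d x *\<^sub>R d"
    by (rule projection_rank_two_timelike[OF P2(1,3) t]) blast
  have "T x - s *\<^sub>R x = (r - s) *\<^sub>R (G a x *\<^sub>R a + G b x *\<^sub>R b)
       - (r + s) *\<^sub>R (G d x *\<^sub>R d - G c x *\<^sub>R c)" for x
    using dec'[of x] ab(6)[of x] cd(6)[of x] by simp
  then show thesis using that[OF rs ab(4,5) cd(4,5) ab(1) _ _ _ _ cd(1)] cross ab(2,3) cd(2,3) by blast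
qed

text \<open>The negative coefficient \<open>- (r + s)\<close> is compensated by
  \<open>G c c = -1\<close>, so both weights are positive.\<close>

lemma two_wedges_timelike:
  assumes less: "s\<^sup>2 < q"
  shows "two_orthogonal_wedges (\<lambda>x. T x - s *\<^sub>R x)"
proof -
  define r where "r = sqrt q"
  obtain a b c d where rs: "\<bar>s\<bar> < r" and e: "G a a = 1" "G b b = 1" "G c c = -1" "G d d = 1"
    "G a b = 0" "G a c = 0" "G a d = 0" "G b c = 0" "G b d = 0" "G c d = 0"
    and Tx: "\<And>x. T x - s *\<^sub>R x = (r - s) *\<^sub>R (G a x *\<^sub>R a + G b x *\<^sub>R b)
       - (r + s) *\<^sub>R (G d x *\<^sub>R d - G c x *\<^sub>R c)"
    unfolding r_def by (rule timelike_case[OF less]) blast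
  show ?thesis
  proof (rule two_orthogonal_wedgesI)
    show "T x - s *\<^sub>R x = (r - s) *\<^sub>R ((G b b * G a x) *\<^sub>R a + (G a a * G b x) *\<^sub>R b)
      + (r + s) *\<^sub>R ((G d d * G c x) *\<^sub>R c + (G c c * G d x) *\<^sub>R d)" for x
      unfolding Tx by (simp add: e algebra_simps)
  qed (use e rs in simp_all)
qed

section \<open>The case \<open>q = s^2\<close>\<close>

text \<open>Vectors \<open>(T^2 - s^2) w\<close> are null eigenvectors for \<open>s > 0\<close>, so
  they vanish by the dominant energy condition. Hence \<open>T - s\<close> is \<open>- 2 s\<close>
  times the projection onto the eigenplane of \<open>- s\<close>, which must contain the timelike
  direction. A single wedge suffices.\<close>

lemma two_wedges_pos:
  assumes eq: "q = s\<^sup>2" and s: "s > 0"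
  shows "two_orthogonal_wedges (\<lambda>x. T x - s *\<^sub>R x)"
proof -
  have TT: "T (T w) = s\<^sup>2 *\<^sub>R w" for w
  proof (rule ccontr)
    define k where "k = T (T w) - s\<^sup>2 *\<^sub>R w"
    assume "T (T w) \<noteq> s\<^sup>2 *\<^sub>R w"
    then have k0: "k \<noteq> 0" by (simp add: k_def)
    have Tk: "T k = s *\<^sub>R k" by (simp add: k_def cubic eq power2_eq_square algebra_simps)
    have "G k k = G k (T (T w)) - s\<^sup>2 * G k w" by (subst (2) k_def) simp
    also have "G k (T (T w)) = s\<^sup>2 * G k w" using Tk by (simp add: power2_eq_square flip: T_sym)
    finally show False using null_eigenvalue_nonpos[OF _ k0 Tk] s by simp
  qed
  have "(- s)\<^sup>2 = q" "- s \<noteq> 0" "- s \<noteq> s" using eq s by auto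
  then obtain P where P: "projection P" "op_trace P = 2"
    "\<And>x. (2 * (- s) * (- s - s)) *\<^sub>R P x = T (T x) + (- s - s) *\<^sub>R T x - (- s * s) *\<^sub>R x"
    by (rule projection_root) blast
  have Tx: "T x - s *\<^sub>R x = (- (2 * s)) *\<^sub>R P x" for x
  proof -
    have "(2 * s) *\<^sub>R ((2 * s) *\<^sub>R P x) = (2 * (- s) * (- s - s)) *\<^sub>R P x"
      by (simp add: algebra_simps)
    also have "\<dots> = (2 * s) *\<^sub>R (s *\<^sub>R x - T x)"
      unfolding P(3) TT by (simp add: vec_eq_iff power2_eq_square algebra_simps)
    finally have "(2 * s) *\<^sub>R P x = s *\<^sub>R x - T x" using s by (simp only: scaleR_cancel_left) simp
    then show ?thesis by simp
  qed
  obtain t where t: "G (P t) (P t) < 0"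
  proof (rule projection_timelike_cases[OF P(1)])
    fix t assume t: "G (t - P t) (t - P t) < 0"
    have "P (t - P t) = 0" using projectionD(2,3)[OF P(1)] by (simp add: linear_diff)
    then have "T (t - P t) = s *\<^sub>R (t - P t)" using Tx[of "t - P t"] by (metis eq_iff_diff_eq_0 scaleR_zero_right)
    then show thesis using timelike_eigenvalue_nonpos[OF t] s by (meson not_le)
  qed (use that in blast)
  obtain c d where cd: "G c d = 0" "G c c = -1" "G d d = 1"
    "\<And>x. P x = (- G c x) *\<^sub>R c + G d x *\<^sub>R d"
    by (rule projection_rank_two_timelike[OF P(1,2) t]) blast
  show ?thesis
  proof (rule two_orthogonal_wedgesI[of c d 0 0 "2 * s" 0])
    show "T x - s *\<^sub>R x = (2 * s) *\<^sub>R ((G d d * G c x) *\<^sub>R c + (G c c * G d x) *\<^sub>R d)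
      + 0 *\<^sub>R ((G 0 0 * G 0 x) *\<^sub>R 0 + (G 0 0 * G 0 x) *\<^sub>R 0)" for x
      unfolding Tx cd(4) by (simp add: cd(2,3) algebra_simps)
  qed (use s in \<open>simp_all add: cd(1)\<close>)
qed

text \<open>With \<open>r = - s\<close>, the root \<open>r\<close> is simple and its eigenplane
  Euclidean, while \<open>- r\<close> is a double root. Hence \<open>T - s\<close> is
  \<open>2 r P\<close> plus the part \<open>N\<close> of \<open>T + r\<close> on the complement,
  which has square zero.\<close>

lemma two_wedges_neg:
  assumes eq: "q = s\<^sup>2" and s: "s < 0"
  shows "two_orthogonal_wedges (\<lambda>x. T x - s *\<^sub>R x)"
proof -
  define r where "r = - s"
  have r: "r > 0" "r\<^sup>2 = q" "r \<noteq> 0" "r \<noteq> s" "s = - r" using s eq by (auto simp: r_def)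
  obtain P where P: "projection P" "\<And>x. T (P x) = r *\<^sub>R P x" "\<And>x. P (T x) = r *\<^sub>R P x" "op_trace P = 2"
    "\<And>x. (2 * r * (r - s)) *\<^sub>R P x = T (T x) + (r - s) *\<^sub>R T x - (r * s) *\<^sub>R x"
    by (rule projection_root[OF r(2-4)]) blast
  note P' = projectionD[OF P(1)]
  obtain t where t: "G (t - P t) (t - P t) < 0"
    by (rule projection_timelike_cases[OF P(1)])
      (use timelike_eigenvalue_nonpos[OF _ P(2)] r in \<open>auto simp: not_le[symmetric]\<close>)
  obtain a b where ab: "G a b = 0" "P a = a" "P b = b" "G a a = 1" "G b b = 1"
    "\<And>x. P x = G a x *\<^sub>R a + G b x *\<^sub>R b"
    by (rule projection_rank_two_spacelike[OF P(1,4) projection_positive[OF P(1) t]]) blast+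
  define N where "N x = T x + r *\<^sub>R x - (2 * r) *\<^sub>R P x" for x
  have TN: "T (N x) = (- r) *\<^sub>R N x" for x
  proof -
    have "T (N x) + r *\<^sub>R N x = T (T x) + (2 * r) *\<^sub>R T x + (r * r) *\<^sub>R x - (4 * r * r) *\<^sub>R P x"
      by (simp add: N_def P(2) vec_eq_iff algebra_simps)
    also have "(4 * r * r) *\<^sub>R P x = T (T x) + (2 * r) *\<^sub>R T x + (r * r) *\<^sub>R x"
      using P(5)[of x] unfolding r(5) by (simp add: mult.assoc)
    finally show ?thesis by (simp add: add_eq_0_iff)
  qed
  have PN: "P (N x) = 0" for x
    using P' by (simp add: N_def linear_diff linear_add linear_scale P(3) vec_eq_iff algebra_simps)
  let ?Q = "\<lambda>x. x - P x"
  show ?thesis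
  proof (rule two_orthogonal_wedges_null[of a b "2 * r" ?Q N])
    show "G a b = 0" "2 * r \<ge> 0" using ab r by simp_all
    show "projection ?Q" by (rule projection_complement[OF P(1)])
    show "op_trace ?Q \<ge> 3" using P(4) card_gt by (simp add: op_trace_diff op_trace_ident)
    show "?Q a = 0" "?Q b = 0" using ab by simp_all
    have "linear N" using P'(2)
      by (intro linearI) (simp_all add: N_def linear_add linear_scale algebra_simps)
    moreover have "G (N x) y = G x (N y)" for x y by (simp add: N_def T_sym P'(4))
    ultimately show "symmetric_op N" by (simp add: symmetric_op_def)
    show "N (N x) = 0" for x using N_def[of "N x"] PN[of x] TN[of x] by simp
    show "?Q (N x) = N x" for x using PN by simp
    show "c \<ge> 0" if k: "k \<noteq> 0" "G k k = 0" "?Q k = k" "\<And>x. N x = (c * G k x) *\<^sub>R k" for k c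
    proof -
      \<comment> \<open>The timelike \<open>w\<close> in the complement is tested against the
        eigenvector \<open>a\<close>: the bound \<open>r * (- G w w) \<le> G w (T w)\<close> reduces
        to \<open>c * (G k w)^2 \<ge> 0\<close>.\<close>
      define w where "w = t - P t"
      have w: "G w w < 0" using t by (simp add: w_def)
      have Pw: "P w = 0" using P' by (simp add: w_def linear_diff)
      have aw: "G w a = 0" using P'(4)[of w a] ab(2) Pw by simp
      have a0: "a \<noteq> 0" using ab(4) by auto
      have "T a = r *\<^sub>R a" using P(2)[of a] ab(2) by simp
      then have "\<bar>r\<bar> * (- G w w) \<le> G w (T w)" using eigenvalue_bound[OF w aw a0] by blast
      moreover have "T w = N w - r *\<^sub>R w" by (simp add: N_def Pw)
      moreover have "G w (N w) = c * (G k w)\<^sup>2" unfolding k(4) by (simp add: G_commute[of w k] power2_eq_square)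
      ultimately have "c * (G k w)\<^sup>2 \<ge> 0" using r(1) by simp
      moreover have "(G k w)\<^sup>2 > 0" using causal_not_orthogonal[OF w, of k] k by simp
      ultimately show ?thesis by (simp add: zero_le_mult_iff)
    qed
    show "T x - s *\<^sub>R x = (2 * r) *\<^sub>R ((G b b * G a x) *\<^sub>R a + (G a a * G b x) *\<^sub>R b) + N x" for x
      unfolding N_def ab(6) r(5) by (simp add: ab(4,5) algebra_simps)
  qed
qed

text \<open>Here \<open>T^3 = 0\<close>. For future \<open>u\<close>, the causal \<open>T u\<close>
  is orthogonal to the null vector \<open>T (T u)\<close>; if the latter were nonzero,
  \<open>T u\<close> would be a multiple of it and \<open>T (T u)\<close> a multiple of
  \<open>T^3 u = 0\<close>. Future vectors span the space, so \<open>T^2 = 0\<close>.\<close>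

lemma two_wedges_zero:
  assumes eq: "q = 0" and s: "s = 0"
  shows "two_orthogonal_wedges (\<lambda>x. T x - s *\<^sub>R x)"
proof -
  have T3: "T (T (T x)) = 0" for x using cubic[of x] eq s by simp
  have TTu: "T (T u) = 0" if u: "future u" for u
  proof (rule ccontr)
    let ?w = "T (T u)"
    assume nz: "?w \<noteq> 0"
    have "G ?w ?w = 0" "G (T u) ?w = 0"
      using T_sym[of "T u" ?w] T_sym[of u ?w] T3 by simp_all
    then obtain m where "T u = m *\<^sub>R ?w"
      using null_orthogonal_parallel[OF _ nz] causal_image[OF u] by blast
    then have "T (T u) = m *\<^sub>R T ?w" by (metis T_simps(4))
    then show False using T3 nz by simp
  qed
  have ft: "future tau" using tau by (auto simp: future_causal_def)
  have TT: "T (T x) = 0" for x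
  proof -
    define M where "M = \<bar>G x tau\<bar> + \<bar>G x x\<bar> + 1"
    define m where "m = - G tau tau"
    have m: "m > 0" using tau by (simp add: m_def)
    \<comment> \<open>Adding this multiple of \<open>tau\<close> makes any given \<open>x\<close>
      future-pointing and causal.\<close>
    define l where "l = 2 * M / m + 1"
    have M: "M \<ge> 1" "\<bar>G x tau\<bar> \<le> M" "G x x \<le> M" by (auto simp: M_def)
    have l: "l \<ge> 1" using M m by (simp add: l_def)
    have lm: "l * m \<ge> 2 * M + m" using m by (simp add: l_def field_simps)
    let ?u = "l *\<^sub>R tau + x"
    have t: "G ?u tau = - (l * m) + G x tau" by (simp add: m_def)
    have uu_eq: "G ?u ?u = - (l * (l * m)) + 2 * (l * G x tau) + G x x"
      by (simp add: m_def G_commute[of tau x] algebra_simps)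
    have "l * (l * m) \<ge> l * (2 * M + m)" using lm l by (intro mult_left_mono) auto
    moreover have "l * G x tau \<le> l * \<bar>G x tau\<bar>" using l by (intro mult_left_mono) auto
    moreover have "l * (2 * \<bar>G x tau\<bar> + \<bar>G x x\<bar> + 1) \<le> l * (2 * M + m)"
      using l m by (intro mult_left_mono) (auto simp: M_def)
    moreover have "1 * \<bar>G x x\<bar> \<le> l * \<bar>G x x\<bar>" using l by (intro mult_right_mono) auto
    ultimately have uu: "G ?u ?u \<le> 0" using l unfolding uu_eq distrib_left by linarith
    have t0: "G ?u tau < 0" using t lm M m by linarith
    moreover have "?u \<noteq> 0" using t0 by (metis G_simps(9) less_irrefl)
    ultimately have "future ?u" using uu unfolding future_causal_def by blast
    then have "T (T ?u) = 0" by (rule TTu)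
    then show ?thesis using TTu[OF ft] by simp
  qed
  show ?thesis
  proof (rule two_orthogonal_wedges_null[of 0 0 0 "\<lambda>x. x" T])
    show "projection (\<lambda>x. x)" by (simp add: projection_def symmetric_op_def linear_id[unfolded id_def])
    show "op_trace (\<lambda>x::real^'n. x) \<ge> 3" using card_gt by (simp add: op_trace_ident)
    show "c \<ge> 0" if k: "k \<noteq> 0" "G k k = 0" "\<And>x. T x = (c * G k x) *\<^sub>R k" for k c
    proof -
      have "G tau (T tau) \<ge> 0" using dec ft by blast
      moreover have "G tau (T tau) = c * (G k tau)\<^sup>2"
        unfolding k(3) by (simp add: G_commute[of tau k] power2_eq_square)
      moreover have "(G k tau)\<^sup>2 > 0" using causal_not_orthogonal[OF tau, of k] k by simp
      ultimately show ?thesis by (simp add: zero_le_mult_iff)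
    qed
  qed (simp_all add: symT TT s)
qed

theorem two_wedges: "two_orthogonal_wedges (\<lambda>x. T x - s *\<^sub>R x)"
  using two_wedges_spacelike two_wedges_timelike two_wedges_pos two_wedges_neg two_wedges_zero
  by (metis linorder_less_linear power_zero_numeral)

end

section \<open>The two-forms of a given superenergy tensor\<close>

context lorentz_space
begin

lemma orthonormal_dim:
  assumes S: "orthonormal S" shows "dim (span S) = card S"
proof -
  have fin: "finite S" using S by (simp add: orthonormal_def)
  have "independent S"
  proof (rule independent_if_scalars_zero[OF fin])
    fix c e assume sum: "(\<Sum>x\<in>S. c x *\<^sub>R x) = 0" and e: "e \<in> S"
    have "0 = G e (\<Sum>x\<in>S. c x *\<^sub>R x)" using sum by simp
    also have "\<dots> = (\<Sum>x\<in>S. c x * G e x)" by (simp add: G_sum_right)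
    also have "\<dots> = (\<Sum>x\<in>S. if x = e then c e * G e e else 0)"
      by (rule sum.cong) (use S e in \<open>auto simp: orthonormal_def\<close>)
    finally have "c e * G e e = 0" using fin e by simp
    then show "c e = 0" using S e by (auto simp: orthonormal_def)
  qed
  then show ?thesis by (simp add: dim_eq_card_independent)
qed

text \<open>A dimension count: the range has dimension at most four and contains four independent
  vectors.\<close>

lemma mixed_range_eq_span:
  assumes F: "form_rank F \<le> 4" and S: "orthonormal S" "card S = 4" "S \<subseteq> range (mixed F)"
  shows "range (mixed F) = span S"
proof -
  have sub: "subspace (range (mixed F))" using linear_mixed linear_subspace_image subspace_UNIV by blast
  have "range (mixed F) = (*v) (matrix_inv g) ` range ((*v) F)" by (auto simp: mixed_def)
  then have "dim (range (mixed F)) \<le> form_rank F"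
    unfolding form_rank_def using dim_image_le[OF matrix_vector_mul_linear] by metis
  then have "dim (range (mixed F)) \<le> dim (span S)" using F orthonormal_dim[OF S(1)] S(2) by simp
  moreover have "span S \<subseteq> range (mixed F)" using S(3) sub by (rule span_minimal)
  ultimately show ?thesis using subspace_dim_equal[OF subspace_span sub] by metis
qed

lemma orthonormal_expansion_span:
  assumes S: "orthonormal S" and x: "x \<in> span S"
  shows "x = (\<Sum>e\<in>S. (G e e * G e x) *\<^sub>R e)"
  using x
proof (induction rule: span_induct_alt)
  case base then show ?case by simp
next
  case (step c e y)
  have "(\<Sum>f\<in>S. (G f f * G f (c *\<^sub>R e + y)) *\<^sub>R f)
      = c *\<^sub>R (\<Sum>f\<in>S. (G f f * G f e) *\<^sub>R f) + (\<Sum>f\<in>S. (G f f * G f y) *\<^sub>R f)"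
    by (simp add: scaleR_sum_right algebra_simps sum.distrib)
  then show ?case using orthonormal_expansion_fixed[OF S step(1)] step(2) by simp
qed

text \<open>The two wedges, with factors 2 against the 1/2 in \<open>wedge\<close>, give
  \<open>A^2 = s - T\<close>. The trace condition yields
  \<open>[A^2] = n s - (n - 4) s = 4 s\<close>, which is the scalar term required.\<close>

lemma superenergy_of_two_orthogonal_wedges:
  assumes B: "two_orthogonal_wedges (\<lambda>x. T *v x - s *\<^sub>R x)"
    and tr: "trace T = (real CARD('n) - 4) * s"
  obtains F where "two_form F" "form_rank F \<le> 4" "superenergy g F = T"
proof -
  obtain u v u' v' where o: "G u v = 0" "G u' v' = 0" "G u u' = 0" "G u v' = 0" "G v u' = 0" "G v v' = 0"
    and T: "\<And>x. T *v x - s *\<^sub>R x = (G v v * G u x) *\<^sub>R u + (G u u * G v x) *\<^sub>R v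
       + (G v' v' * G u' x) *\<^sub>R u' + (G u' u' * G v' x) *\<^sub>R v'"
    using B unfolding two_orthogonal_wedges_def by blast
  have o': "G v u = 0" "G v' u' = 0" "G u' u = 0" "G v' u = 0" "G u' v = 0" "G v' v = 0"
    using o by (simp_all add: G_commute)
  define F where "F = wedge g (2 *\<^sub>R u) v + wedge g (2 *\<^sub>R u') v'"
  have F: "two_form F" by (simp add: F_def two_form_add two_form_wedge)
  have rank: "form_rank F \<le> 4" unfolding F_def by (rule form_rank_two_wedges)
  have A: "mixed F x = G v x *\<^sub>R u - G u x *\<^sub>R v + (G v' x *\<^sub>R u' - G u' x *\<^sub>R v')" for x
    by (simp add: F_def mixed_add mixed_wedge)
  have AA: "mixed F (mixed F x) = s *\<^sub>R x - T *v x" for x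
  proof -
    have "mixed F (mixed F x) = - (T *v x - s *\<^sub>R x)"
      unfolding T by (simp add: A o o' vec_eq_iff algebra_simps)
    then show ?thesis by simp
  qed
  have "op_trace (\<lambda>x. mixed F (mixed F x)) = 4 * s"
    unfolding AA by (simp add: op_trace_simps op_trace_matrix tr algebra_simps)
  then have "superenergy g F *v x = T *v x" for x
    using superenergy_apply[OF F, of x] AA[of x] by simp
  then have "superenergy g F = T" by (simp add: matrix_eq)
  then show thesis using that F rank by blast
qed

end

context dominant_cubic
begin

text \<open>The range of \<open>A\<close> is the four-dimensional complement of the eigenspace of
  \<open>s\<close>, which is Euclidean. Both simple summands are built from vectors in this
  range.\<close>

lemma sum_of_two_spacelike:
  assumes less: "q < s\<^sup>2" and F: "two_form F" "form_rank F \<le> 4"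
    and T: "\<And>x. T x = s *\<^sub>R x - mixed F (mixed F x)"
  shows "\<exists>F1 F2. simple_spacelike g F1 \<and> simple_spacelike g F2 \<and> F = F1 + F2"
proof -
  let ?A = "mixed F"
  note lA = linear_scale[OF linear_mixed[of F]]
  obtain P t where P: "projection P" "\<And>x. T (P x) = s *\<^sub>R P x"
    "\<And>x. P (T x) = s *\<^sub>R P x" "op_trace P = real CARD('n) - 4"
    "\<And>x. (s\<^sup>2 - q) *\<^sub>R P x = T (T x) - q *\<^sub>R x"
    and t: "G (P t) (P t) < 0"
    by (rule spacelike_case[OF less]) blast
  let ?Q = "\<lambda>x. x - P x"
  have tr4: "op_trace ?Q = 4" using P(4) by (simp add: op_trace_diff op_trace_ident)
  obtain S where S: "orthonormal S" "\<And>x. ?Q x = (\<Sum>e\<in>S. (G e e * G e x) *\<^sub>R e)"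
    "op_trace ?Q = real (card S)" "\<And>e. e \<in> S \<Longrightarrow> ?Q e = e"
    by (rule projection_orthonormal_basis[OF projection_complement[OF P(1)]]) blast
  have "S \<subseteq> range ?A"
  proof
    fix e assume "e \<in> S"
    then have "P e = 0" using S(4)[of e] by simp
    then have TT: "T (T e) = q *\<^sub>R e" using P(5)[of e] by simp
    \<comment> \<open>With \<open>A^2 = s - T\<close>, the factorization
      \<open>(s - T) (s + T) = s^2 - T^2\<close> exhibits \<open>e\<close> as an image under
      \<open>A\<close>.\<close>
    have "?A (?A (T e + s *\<^sub>R e)) = s *\<^sub>R (T e + s *\<^sub>R e) - T (T e + s *\<^sub>R e)"
      using T[of "T e + s *\<^sub>R e"] by (simp add: algebra_simps)
    also have "\<dots> = (s\<^sup>2 - q) *\<^sub>R e" by (simp add: TT power2_eq_square algebra_simps)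
    finally have "(1 / (s\<^sup>2 - q)) *\<^sub>R ?A (?A (T e + s *\<^sub>R e)) = e" using less by simp
    then have "e = ?A ((1 / (s\<^sup>2 - q)) *\<^sub>R ?A (T e + s *\<^sub>R e))" by (simp add: lA)
    then show "e \<in> range ?A" by blast
  qed
  then have range: "range ?A = span S" using mixed_range_eq_span[OF F(2) S(1)] tr4 S(3) by simp
  have pos: "G w w > 0" if w: "w \<in> span S" "w \<noteq> 0" for w
  proof -
    have "?Q w = w" using orthonormal_expansion_span[OF S(1) w(1)] S(2)[of w] by simp
    then show ?thesis using projection_complement_positive[OF P(1) t, of w] w(2) by auto
  qed
  obtain a b c d where abcd: "F = wedge g a b + wedge g c d" "{a, b, c, d} \<subseteq> range (mixed F)"
    by (rule two_form_rank_four_wedges[OF F]) blast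
  have "span {a, b} \<subseteq> span S" "span {c, d} \<subseteq> span S"
    using abcd(2) by (simp_all add: range span_minimal)
  then have "simple_spacelike g (wedge g a b)" "simple_spacelike g (wedge g c d)"
    unfolding simple_spacelike_def using pos by blast+
  then show ?thesis using abcd(1) by blast
qed

text \<open>\<open>A\<close> commutes with \<open>T\<close> and preserves the planes of
  \<open>a, b\<close> and of \<open>c, d\<close>, whose sum is its range. Being skew, it is a
  multiple of a rotation generator in the first plane and of a boost generator in the second, and
  each multiple is a simple form.\<close>

lemma sum_of_spacelike_and_timelike:
  assumes less: "s\<^sup>2 < q" and F: "two_form F" "form_rank F \<le> 4"
    and T: "\<And>x. T x = s *\<^sub>R x - mixed F (mixed F x)"
  shows "\<exists>F1 F2. simple_spacelike g F1 \<and> simple_timelike g F2 \<and> F = F1 + F2"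
proof -
  define A where "A = mixed F"
  have lin: "linear A" unfolding A_def by (rule linear_mixed)
  note lA = linear_diff[OF lin] linear_scale[OF lin]
  have T: "T x = s *\<^sub>R x - A (A x)" for x using T by (simp add: A_def)
  have skew: "G x (A y) = - G (A x) y" for x y using mixed_skew[OF F(1), of x y] by (simp add: A_def)
  have self: "G x (A x) = 0" for x using skew[of x x] by (simp add: G_commute)
  define r where "r = sqrt q"
  obtain a b c d where rs: "\<bar>s\<bar> < r" and e: "G a a = 1" "G b b = 1" "G c c = -1" "G d d = 1"
    "G a b = 0" "G a c = 0" "G a d = 0" "G b c = 0" "G b d = 0" "G c d = 0"
    and Tx: "\<And>x. T x - s *\<^sub>R x = (r - s) *\<^sub>R (G a x *\<^sub>R a + G b x *\<^sub>R b)
       - (r + s) *\<^sub>R (G d x *\<^sub>R d - G c x *\<^sub>R c)"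
    unfolding r_def by (rule timelike_case[OF less]) blast
  have e': "G b a = 0" "G c a = 0" "G d a = 0" "G c b = 0" "G d b = 0" "G d c = 0"
    using e by (simp_all add: G_commute)
  have AA: "A (A a) = (s - r) *\<^sub>R a" "A (A b) = (s - r) *\<^sub>R b"
    "A (A c) = (r + s) *\<^sub>R c" "A (A d) = (r + s) *\<^sub>R d"
    using Tx[of a] Tx[of b] Tx[of c] Tx[of d] by (simp_all add: T e e' algebra_simps)
  have Te: "T a = r *\<^sub>R a" "T b = r *\<^sub>R b" "T c = (- r) *\<^sub>R c" "T d = (- r) *\<^sub>R d"
    by (simp_all add: T AA algebra_simps)
  have TA: "T (A x) = m *\<^sub>R A x" if "T x = m *\<^sub>R x" for x m
  proof -
    have "T (A x) = A (T x)" by (simp add: T lA)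
    then show ?thesis using that by (simp add: lA)
  qed
  have nr: "r \<noteq> - r" "- r \<noteq> r" using rs by auto
  have cross: "G c (A a) = 0" "G d (A a) = 0" "G c (A b) = 0" "G d (A b) = 0"
    "G a (A c) = 0" "G b (A c) = 0" "G a (A d) = 0" "G b (A d) = 0"
    by (rule eigenvectors_orthogonal[OF symT Te(3) TA[OF Te(1)] nr(2)]
        eigenvectors_orthogonal[OF symT Te(4) TA[OF Te(1)] nr(2)]
        eigenvectors_orthogonal[OF symT Te(3) TA[OF Te(2)] nr(2)]
        eigenvectors_orthogonal[OF symT Te(4) TA[OF Te(2)] nr(2)]
        eigenvectors_orthogonal[OF symT Te(1) TA[OF Te(3)] nr(1)]
        eigenvectors_orthogonal[OF symT Te(2) TA[OF Te(3)] nr(1)]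
        eigenvectors_orthogonal[OF symT Te(1) TA[OF Te(4)] nr(1)]
        eigenvectors_orthogonal[OF symT Te(2) TA[OF Te(4)] nr(1)])+
  let ?S = "{a, b, c, d}"
  have distinct: "a \<noteq> b" "a \<noteq> c" "a \<noteq> d" "b \<noteq> c" "b \<noteq> d" "c \<noteq> d" using e by auto
  have S: "orthonormal ?S" unfolding orthonormal_def using e e' by auto
  have card: "card ?S = 4" using distinct by simp
  have preimage: "x \<in> range A" if "A (A x) = m *\<^sub>R x" "m \<noteq> 0" for x m
  proof -
    have "x = A ((1 / m) *\<^sub>R A x)" using that by (simp add: lA)
    then show ?thesis by blast
  qed
  have "?S \<subseteq> range (mixed F)" unfolding A_def[symmetric]
    using preimage[OF AA(1)] preimage[OF AA(2)] preimage[OF AA(3)] preimage[OF AA(4)] rs by auto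
  from mixed_range_eq_span[OF F(2) S card this] have "A x \<in> span ?S" for x unfolding A_def by blast
  from orthonormal_expansion_span[OF S this]
  have expand: "A x = G a (A x) *\<^sub>R a + (G b (A x) *\<^sub>R b + (- G c (A x) *\<^sub>R c + G d (A x) *\<^sub>R d))" for x
    using distinct by (simp add: e)
  define p where "p = G b (A a)"
  define k where "k = G d (A c)"
  have Aa: "A a = p *\<^sub>R b" using expand[of a] by (simp add: cross self p_def)
  have Ac: "A c = k *\<^sub>R d" using expand[of c] by (simp add: cross self k_def)
  have "G a (A b) = - p" "G c (A d) = - k"
    using skew[of a b] skew[of c d] by (simp_all add: Aa Ac e)
  then have Ab: "A b = - p *\<^sub>R a" and Ad: "A d = k *\<^sub>R c"
    using expand[of b] expand[of d] by (simp_all add: cross self)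
  \<comment> \<open>A zero coefficient would leave no timelike direction in the second plane's
    spanning pair; it is excluded because \<open>A^2 c = (r + s) c\<close> is nonzero.\<close>
  have k0: "k \<noteq> 0"
  proof
    assume "k = 0"
    then have "(r + s) *\<^sub>R c = 0" using AA(3) by (simp add: Ac linear_0[OF lin])
    then show False using rs e(3) by auto
  qed
  have "A x = mixed (wedge g ((- 2 * p) *\<^sub>R a) b + wedge g ((2 * k) *\<^sub>R c) d) x" for x
    using expand[of x] skew[of a x] skew[of b x] skew[of c x] skew[of d x]
    by (simp add: Aa Ab Ac Ad mixed_add mixed_wedge algebra_simps)
  then have "F = wedge g ((- 2 * p) *\<^sub>R a) b + wedge g ((2 * k) *\<^sub>R c) d"
    by (intro mixed_inject) (auto simp: A_def)
  moreover have "simple_spacelike g (wedge g ((- 2 * p) *\<^sub>R a) b)"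
    unfolding simple_spacelike_def
  proof (intro exI conjI ballI impI, rule refl)
    fix w assume w: "w \<in> span {(- 2 * p) *\<^sub>R a, b}" "w \<noteq> 0"
    have "span {(- 2 * p) *\<^sub>R a, b} \<subseteq> span {a, b}"
      by (intro span_minimal) (auto intro: span_scale span_neg span_base)
    then have "w \<in> span {a, b}" using w(1) by blast
    then obtain x y where xy: "w = x *\<^sub>R a + y *\<^sub>R b"
      by (auto simp: span_insert span_singleton algebra_simps)
    then have "G w w = x\<^sup>2 + y\<^sup>2" by (simp add: e e' power2_eq_square)
    moreover have "x \<noteq> 0 \<or> y \<noteq> 0" using xy w(2) by auto
    ultimately show "G w w > 0" by (simp add: sum_power2_gt_zero_iff)
  qed
  moreover have "simple_timelike g (wedge g ((2 * k) *\<^sub>R c) d)"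
    unfolding simple_timelike_def
  proof (intro exI conjI bexI, rule refl)
    show "G ((2 * k) *\<^sub>R c) ((2 * k) *\<^sub>R c) < 0" using k0 e(3) by (simp flip: power2_eq_square)
  qed (simp add: span_base)
  ultimately show ?thesis by blast
qed

end

section \<open>Lorentz metrics as matrices\<close>

text \<open>Orthogonality equates the product of the time components with the Euclidean product of
  the spatial parts \<open>sp\<close>, to which Cauchy-Schwarz applies.\<close>

lemma minkowski_reverse:
  fixes a b :: "real^'n" and i0 :: 'n
  defines "\<eta> \<equiv> \<lambda>x y :: real^'n. x \<bullet> (minkowski_diag i0 *v y)"
  assumes "\<eta> a a < 0" "\<eta> a b = 0" "b \<noteq> 0"
  shows "\<eta> b b > 0"
proof -
  define sp :: "real^'n \<Rightarrow> real^'n" where "sp x = (\<chi> i. if i = i0 then 0 else x $ i)" for x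
  have \<eta>: "\<eta> x y = sp x \<bullet> sp y - x $ i0 * y $ i0" for x y
  proof -
    have "\<eta> x y = (\<Sum>i\<in>UNIV. sp x $ i * sp y $ i - (if i = i0 then x $ i0 * y $ i0 else 0))"
      unfolding \<eta>_def inner_vec_def
    proof (rule sum.cong[OF refl])
      fix i
      have "(minkowski_diag i0 *v y) $ i = (\<Sum>j\<in>UNIV. if j = i then (if i = i0 then - y $ i else y $ i) else 0)"
        unfolding minkowski_diag_def matrix_vector_mult_def vec_lambda_beta
        by (rule sum.cong) auto
      then have "(minkowski_diag i0 *v y) $ i = (if i = i0 then - y $ i else y $ i)" by simp
      then show "x $ i \<bullet> (minkowski_diag i0 *v y) $ i
          = sp x $ i * sp y $ i - (if i = i0 then x $ i0 * y $ i0 else 0)"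
        by (simp add: sp_def)
    qed
    then show ?thesis by (simp add: sum_subtractf inner_vec_def)
  qed
  let ?a = "sp a \<bullet> sp a" and ?b = "sp b \<bullet> sp b"
  have 1: "?a < (a $ i0)\<^sup>2" using assms(2) by (simp add: \<eta> power2_eq_square)
  have 2: "(a $ i0)\<^sup>2 * (b $ i0)\<^sup>2 \<le> ?a * ?b"
    using Cauchy_Schwarz_ineq[of "sp a" "sp b"] assms(3) by (simp add: \<eta> power_mult_distrib)
  have a0: "(a $ i0)\<^sup>2 > 0" using 1 inner_ge_zero[of "sp a"] by linarith
  have "?b > (b $ i0)\<^sup>2"
  proof (cases "?b = 0")
    case True
    then have "(a $ i0)\<^sup>2 * (b $ i0)\<^sup>2 \<le> 0" using 2 by simp
    then have "b $ i0 = 0" using a0 by (simp add: mult_le_0_iff)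
    moreover have "b $ i = 0" if "i \<noteq> i0" for i
    proof -
      have "sp b $ i = 0" using True by simp
      then show ?thesis using that by (simp add: sp_def)
    qed
    ultimately have "b $ i = 0" for i by (cases "i = i0") auto
    then have "b = 0" by (simp add: vec_eq_iff)
    then show ?thesis using assms(4) by simp
  next
    case False
    then have "?b > 0" using inner_ge_zero[of "sp b"] by linarith
    then have "?a * ?b < (a $ i0)\<^sup>2 * ?b" using 1 by simp
    then have "(a $ i0)\<^sup>2 * (b $ i0)\<^sup>2 < (a $ i0)\<^sup>2 * ?b" using 2 by linarith
    then show ?thesis using a0 by simp
  qed
  then show ?thesis by (simp add: \<eta> power2_eq_square)
qed

lemma lorentz_metric_lorentz_space:
  fixes g :: "real^'n^'n"
  assumes "lorentz_metric g" shows "lorentz_space g"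
proof -
  obtain P :: "real^'n^'n" and i0 where sym: "transpose g = g" and inv: "invertible P"
    and P: "transpose P ** g ** P = minkowski_diag i0"
    using assms unfolding lorentz_metric_def by blast
  have G: "gprod g (P *v x) (P *v y) = x \<bullet> (minkowski_diag i0 *v y)" for x y
  proof -
    have "x \<bullet> (minkowski_diag i0 *v y) = x \<bullet> (transpose P *v (g *v (P *v y)))"
      by (simp only: P[symmetric] matrix_vector_mul_assoc matrix_mul_assoc)
    also have "\<dots> = (P *v x) \<bullet> (g *v (P *v y))"
      by (metis dot_lmul_matrix inner_commute transpose_matrix_vector)
    finally show ?thesis by (simp add: gprod_def)
  qed
  have surj: "\<exists>a. x = P *v a" for x
    using inv by (metis invertible_def matrix_vector_mul_assoc matrix_vector_mul_lid)
  show ?thesis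
  proof
    show "transpose g = g" by (rule sym)
    have "(minkowski_diag i0 *v axis i0 1) $ i0 = - 1"
      by (simp add: matrix_vector_mult_basis column_def minkowski_diag_def)
    then have "gprod g (P *v axis i0 1) (P *v axis i0 1) < 0"
      unfolding G by (simp add: inner_axis')
    then show "\<exists>t. gprod g t t < 0" by blast
    fix t x assume tx: "gprod g t t < 0" "gprod g t x = 0" "x \<noteq> 0"
    obtain a b where ab: "t = P *v a" "x = P *v b" using surj by meson
    then have "b \<noteq> 0" using tx(3) by auto
    then show "gprod g x x > 0"
      using minkowski_reverse[of a i0 b] tx unfolding ab G by blast
  qed
qed

lemma cubic_matrix_iff:
  fixes T :: "real^'n^'n"
  shows "(T ** T - mat a + mat b) ** (T - mat s) = 0 \<longleftrightarrow>
    (\<forall>x. T *v (T *v (T *v x)) = s *\<^sub>R (T *v (T *v x)) + (a - b) *\<^sub>R (T *v x) - ((a - b) * s) *\<^sub>R x)"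
proof -
  have "((T ** T - mat a + mat b) ** (T - mat s)) *v x
      = T *v (T *v (T *v x)) - (s *\<^sub>R (T *v (T *v x)) + (a - b) *\<^sub>R (T *v x) - ((a - b) * s) *\<^sub>R x)" for x
    by (simp add: mat_mult_vec matrix_vector_mult_diff_rdistrib matrix_vector_mult_add_rdistrib
        matrix_vector_mult_diff_distrib matrix_vector_mult_scaleR algebra_simps
        flip: matrix_vector_mul_assoc)
  then show ?thesis by (subst matrix_eq) simp
qed

lemma dominant_energy_iff:
  "dominant_energy g tau T \<longleftrightarrow>
    (\<forall>u v. future_causal g tau u \<longrightarrow> future_causal g tau v \<longrightarrow> gprod g u (T *v v) \<ge> 0)"
proof -
  have "(\<Sum>a\<in>UNIV. \<Sum>b\<in>UNIV. (g ** T) $ a $ b * u $ a * v $ b) = gprod g u (T *v v)" for u v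
  proof -
    have "gprod g u (T *v v) = u \<bullet> ((g ** T) *v v)" by (simp add: gprod_def matrix_vector_mul_assoc)
    also have "\<dots> = (\<Sum>a\<in>UNIV. \<Sum>b\<in>UNIV. (g ** T) $ a $ b * u $ a * v $ b)"
      unfolding inner_vec_def matrix_vector_mult_def[of "g ** T"]
      by (simp add: sum_distrib_left mult_ac)
    finally show ?thesis by simp
  qed
  then show ?thesis by (simp add: dominant_energy_def)
qed

lemma (in lorentz_space) symmetric_op_matrix:
  assumes "g_symmetric g T" shows "symmetric_op (\<lambda>x. T *v x)"
proof -
  have "transpose (g ** T) = g ** T"
    using assms by (simp add: g_symmetric_def transpose_def vec_eq_iff)
  then have *: "y v* (g ** T) = (g ** T) *v y" for y by (metis transpose_matrix_vector)
  have "G (T *v x) y = G x (T *v y)" for x y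
  proof -
    have "G (T *v x) y = y \<bullet> ((g ** T) *v x)"
      by (subst G_commute) (simp add: gprod_def matrix_vector_mul_assoc)
    also have "\<dots> = ((g ** T) *v y) \<bullet> x" by (simp only: dot_lmul_matrix[symmetric] *)
    finally show ?thesis by (simp add: gprod_def matrix_vector_mul_assoc inner_commute)
  qed
  then show ?thesis by (simp add: symmetric_op_def)
qed

theorem theorem6:
  fixes g T :: "real^'n^'n" and tau :: "real^'n"
  assumes n_gt: "CARD('n) > 4"
    and lor: "lorentz_metric g"
    and tau: "gprod g tau tau < 0"
    and symT: "g_symmetric g T"
  defines "n \<equiv> real CARD('n)"
  shows "((\<exists>F. two_form F \<and> form_rank F \<le> 4 \<and> superenergy g F = T) \<longleftrightarrow>
            (dominant_energy g tau T \<and>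
             (T ** T - mat ((1/4) * trace (T ** T)) + mat ((1 / (4 * (n - 4))) * (trace T)^2))
               ** (T - mat ((1 / (n - 4)) * trace T)) = 0))
       \<and> ((n - 4)^2 * trace (T ** T) < n * (trace T)^2 \<longrightarrow>
            (\<forall>F. two_form F \<and> form_rank F \<le> 4 \<and> superenergy g F = T \<longrightarrow>
               (\<exists>F1 F2. simple_spacelike g F1 \<and> simple_spacelike g F2 \<and> F = F1 + F2)))
       \<and> ((n - 4)^2 * trace (T ** T) > n * (trace T)^2 \<longrightarrow>
            (\<forall>F. two_form F \<and> form_rank F \<le> 4 \<and> superenergy g F = T \<longrightarrow>
               (\<exists>F1 F2. simple_spacelike g F1 \<and> simple_timelike g F2 \<and> F = F1 + F2)))"
proof -
  interpret lorentz_space g by (rule lorentz_metric_lorentz_space[OF lor])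
  define s where "s = (1 / (n - 4)) * trace T"
  define q where "q = (1/4) * trace (T ** T) - (1 / (4 * (n - 4))) * (trace T)^2"
  have n4: "n - 4 > 0" using n_gt by (simp add: n_def)
  have trace_T: "trace T = (n - 4) * s" using n4 by (simp add: s_def)
  have trace_TT: "trace (T ** T) = 4 * q + (n - 4) * s\<^sup>2"
  proof -
    have "(1 / (4 * m)) * (m * s)\<^sup>2 = m * s\<^sup>2 / 4" if "m > 0" for m :: real
      using that by (simp add: power2_eq_square)
    from this[OF n4] have "(1 / (4 * (n - 4))) * (trace T)^2 = (n - 4) * s\<^sup>2 / 4"
      unfolding trace_T .
    then have "q = (1/4) * trace (T ** T) - (n - 4) * s\<^sup>2 / 4" by (simp only: q_def)
    then show ?thesis by simp
  qed
  \<comment> \<open>The two inequalities on the traces thus decide the sign of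
    \<open>q - s^2\<close>.\<close>
  have cond: "(n - 4)^2 * trace (T ** T) - n * (trace T)^2 = 4 * (n - 4)\<^sup>2 * (q - s\<^sup>2)"
    unfolding trace_T trace_TT by (simp add: power2_eq_square algebra_simps)
  have cubic_iff: "(T ** T - mat ((1/4) * trace (T ** T)) + mat ((1 / (4 * (n - 4))) * (trace T)^2))
      ** (T - mat ((1 / (n - 4)) * trace T)) = 0 \<longleftrightarrow>
    (\<forall>x. T *v (T *v (T *v x)) = s *\<^sub>R (T *v (T *v x)) + q *\<^sub>R (T *v x) - (q * s) *\<^sub>R x)"
    unfolding cubic_matrix_iff s_def[symmetric] q_def[symmetric] ..
  \<comment> \<open>Besides one direction of the equivalence, these facts place every given form
    \<open>F\<close> in the setting where its summands are classified.\<close>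
  have forward: "dominant_energy g tau T \<and>
      (\<forall>x. T *v (T *v (T *v x)) = s *\<^sub>R (T *v (T *v x)) + q *\<^sub>R (T *v x) - (q * s) *\<^sub>R x) \<and>
      (\<forall>x. T *v x = s *\<^sub>R x - mixed F (mixed F x))"
    if F: "two_form F" "form_rank F \<le> 4" "superenergy g F = T" for F
  proof -
    have "(n - 4) * s = (n - 4) * (op_trace (\<lambda>x. mixed F (mixed F x)) / 4)"
      using superenergy_traces(1)[OF F(1)] trace_T F(3) by (simp add: n_def)
    then have s: "op_trace (\<lambda>x. mixed F (mixed F x)) / 4 = s" using n4 by simp
    have T: "T *v x = s *\<^sub>R x - mixed F (mixed F x)" for x
      using superenergy_apply[OF F(1), of x] unfolding s F(3) .
    have "(trace (T ** T) - (n - 4) * s\<^sup>2) / 4 = q" by (simp add: trace_TT)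
    then have "T *v (T *v (T *v x)) = s *\<^sub>R (T *v (T *v x)) + q *\<^sub>R (T *v x) - (q * s) *\<^sub>R x" for x
      using superenergy_cubic[OF F(1,2), of x] unfolding s F(3) n_def[symmetric] by simp
    moreover have "dominant_energy g tau T"
      unfolding dominant_energy_iff
    proof (intro allI impI)
      fix u v assume uv: "future_causal g tau u" "future_causal g tau v"
      have "G (mixed F u) (mixed F v) + s * G u v \<ge> 0"
        using skew_energy_dominant[OF linear_mixed mixed_skew[OF F(1)] tau uv] unfolding s .
      moreover have "G u (mixed F (mixed F v)) = - G (mixed F u) (mixed F v)"
        using mixed_skew[OF F(1), of u "mixed F v"] by simp
      ultimately show "G u (T *v v) \<ge> 0" by (simp add: T)
    qed
    ultimately show ?thesis using T by blast
  qed
  have cubic_locale: "dominant_cubic g tau (\<lambda>x. T *v x) s q"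
    if "dominant_energy g tau T"
      "\<forall>x. T *v (T *v (T *v x)) = s *\<^sub>R (T *v (T *v x)) + q *\<^sub>R (T *v x) - (q * s) *\<^sub>R x"
  proof
    show "G tau tau < 0" by (rule tau)
    show "symmetric_op (\<lambda>x. T *v x)" by (rule symmetric_op_matrix[OF symT])
    show "G u (T *v v) \<ge> 0" if "future_causal g tau u" "future_causal g tau v" for u v
      using that \<open>dominant_energy g tau T\<close> unfolding dominant_energy_iff by blast
    show "CARD('n) > 4" by (rule n_gt)
    show "op_trace (\<lambda>x. T *v x) = (real CARD('n) - 4) * s" by (simp add: op_trace_matrix trace_T n_def)
    show "op_trace (\<lambda>x. T *v (T *v x)) = 4 * q + (real CARD('n) - 4) * s\<^sup>2"
      using op_trace_matrix[of "T ** T"] trace_TT by (simp add: n_def flip: matrix_vector_mul_assoc)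
    show "T *v (T *v (T *v x)) = s *\<^sub>R (T *v (T *v x)) + q *\<^sub>R (T *v x) - (q * s) *\<^sub>R x" for x
      using that(2) by blast
  qed
  have 1: "(\<exists>F. two_form F \<and> form_rank F \<le> 4 \<and> superenergy g F = T) \<longleftrightarrow> (dominant_energy g tau T \<and>
      (\<forall>x. T *v (T *v (T *v x)) = s *\<^sub>R (T *v (T *v x)) + q *\<^sub>R (T *v x) - (q * s) *\<^sub>R x))"
  proof
    assume "\<exists>F. two_form F \<and> form_rank F \<le> 4 \<and> superenergy g F = T"
    then show "dominant_energy g tau T \<and>
      (\<forall>x. T *v (T *v (T *v x)) = s *\<^sub>R (T *v (T *v x)) + q *\<^sub>R (T *v x) - (q * s) *\<^sub>R x)"
      using forward by blast
  next
    assume "dominant_energy g tau T \<and>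
      (\<forall>x. T *v (T *v (T *v x)) = s *\<^sub>R (T *v (T *v x)) + q *\<^sub>R (T *v x) - (q * s) *\<^sub>R x)"
    then interpret dominant_cubic g tau "\<lambda>x. T *v x" s q using cubic_locale by blast
    have "trace T = (real CARD('n) - 4) * s" using trace_T unfolding n_def .
    from superenergy_of_two_orthogonal_wedges[OF two_wedges this]
    show "\<exists>F. two_form F \<and> form_rank F \<le> 4 \<and> superenergy g F = T" by blast
  qed
  have 2: "\<exists>F1 F2. simple_spacelike g F1 \<and> simple_spacelike g F2 \<and> F = F1 + F2"
    if less: "(n - 4)^2 * trace (T ** T) < n * (trace T)^2"
      and F: "two_form F" "form_rank F \<le> 4" "superenergy g F = T" for F
  proof -
    interpret dominant_cubic g tau "\<lambda>x. T *v x" s q using cubic_locale forward[OF F] by blast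
    have "4 * (n - 4)\<^sup>2 * (q - s\<^sup>2) < 0" using less cond by linarith
    then have "q < s\<^sup>2" using n4 by (simp add: mult_less_0_iff)
    then show ?thesis using sum_of_two_spacelike F(1,2) forward[OF F] by blast
  qed
  have 3: "\<exists>F1 F2. simple_spacelike g F1 \<and> simple_timelike g F2 \<and> F = F1 + F2"
    if less: "(n - 4)^2 * trace (T ** T) > n * (trace T)^2"
      and F: "two_form F" "form_rank F \<le> 4" "superenergy g F = T" for F
  proof -
    interpret dominant_cubic g tau "\<lambda>x. T *v x" s q using cubic_locale forward[OF F] by blast
    have "4 * (n - 4)\<^sup>2 * (q - s\<^sup>2) > 0" using less cond by linarith
    then have "s\<^sup>2 < q" using n4 by (simp add: zero_less_mult_iff)
    then show ?thesis using sum_of_spacelike_and_timelike F(1,2) forward[OF F] by blast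
  qed
  show ?thesis unfolding cubic_iff using 1 2 3 by blast
qed

end
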